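(* The following identities of power series in $q$ hold: $$\left(\sum_{k,m\ge0}-\sum_{k,m<0}\right)_{k\equiv m\ (\mathrm{mod}\ 2)}(-1)^mq^{k^2/2+m^2/2+4km+k/2+3m/2}=\prod_{n>0}(1+q^n)\left(\sum_{k,m\ge0}-\sum_{k,m<0}\right)(-1)^{k+m}q^{3k^2+m^2/2+4km+k+m/2},$$ $$\left(\sum_{k,m\ge0}-\sum_{k,m<0}\right)_{k\equiv m\ (\mathrm{mod}\ 2)}(-1)^mq^{k^2/2+m^2/2+4km+3k/2+5m/2}=\prod_{n>0}(1+q^n)\left(\sum_{k,m\ge0}-\sum_{k,m<0}\right)(-1)^{k+m}q^{3k^2+m^2/2+4km+3k+3m/2}.$$
   Context: The summation indices $k,m$ are integers. The notation $\left(\sum_{k,m\ge0}-\sum_{k,m<0}\right)$ means the sum over pairs with both $k,m\ge0$ minus the sum over pairs with both $k,m<0$; the subscript $k\equiv m\ (\mathrm{mod}\ 2)$ restricts both sums to pairs with $k$ and $m$ of the same parity. *)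

theory Defs
  imports "HOL-Analysis.Analysis"
begin

text \<open>
  Everything lives in \<open>\<int>[[q]]\<close>, i.e. in the type \<^typ>\<open>int fps\<close> with \<open>q =\<close> \<^term>\<open>fps_X\<close>.
  Infinite sums and products are taken in its coefficientwise (\<open>q\<close>-adic) topology.

  The exponents below are half-integral expressions whose value is always a natural number on the
  summation range, so \<open>q_pow\<close> takes a real argument. The rounding in its definition never takes
  effect: see \<open>q_pow_of_nat\<close> and the \<open>exponent\<close> lemmas.
\<close>

definition q_pow :: "real \<Rightarrow> int fps" where
  "q_pow x = fps_X ^ nat \<lfloor>x\<rfloor>"

lemma q_pow_of_nat: "q_pow (of_nat n) = fps_X ^ n"
  by (simp add: q_pow_def)

text \<open>
  The operator \<open>\<Sum>\<^bsub>k,m\<ge>0\<^esub> - \<Sum>\<^bsub>k,m<0\<^esub>\<close>, both sums restricted to pairs \<open>(k, m) \<in> S\<close>. Note that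
  \<^const>\<open>infsum\<close> is \<open>0\<close> on families that are not summable; the families used here are
  summable (see the \<open>summable\<close> lemmas).
\<close>

definition indef_sum :: "(int \<times> int) set \<Rightarrow> (int \<Rightarrow> int \<Rightarrow> int fps) \<Rightarrow> int fps" where
  "indef_sum S f = (\<Sum>\<^sub>\<infinity>(k, m) \<in> S \<inter> {0..} \<times> {0..}. f k m) - (\<Sum>\<^sub>\<infinity>(k, m) \<in> S \<inter> {..<0} \<times> {..<0}. f k m)"

definition same_parity :: "(int \<times> int) set" where
  "same_parity = {(k, m). k mod 2 = m mod 2}"


text \<open>Well-definedness: the exponents are natural numbers, and the sums and the product converge.\<close>

lemma quadrant_cases:
  fixes k m :: int
  assumes "(k, m) \<in> {0..} \<times> {0..} \<union> {..<0} \<times> {..<0}"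
  obtains "k \<ge> 0" "m \<ge> 0" "k * m \<ge> 0" "k * k \<ge> k" "m * m \<ge> m"
  | "k < 0" "m < 0" "k * m \<ge> - k" "k * m \<ge> - m" "k * k \<ge> - k" "m * m \<ge> - m"
proof (cases "k \<ge> 0")
  case True
  with assms have m: "m \<ge> 0" by auto
  have "x * x \<ge> x" if "x \<ge> 0" for x :: int
    using that mult_left_mono[of 1 x x] by (cases "x = 0") auto
  with True m that(1) show ?thesis by simp
next
  case False
  with assms have neg: "k < 0" "m < 0" by auto
  have *: "x * y \<ge> - x" if "x < 0" "y < 0" for x y :: int
    using that mult_left_mono_neg[of y "-1" x] by simp
  from that(2) neg *[of k m] *[of m k] *[of k k] *[of m m] show ?thesis
    by (simp add: mult.commute)
qed

lemma Nats_bound_from_int: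
  fixes x :: real and d B :: int
  assumes "x = of_int d / 2" "even d" "d \<ge> B" "B \<ge> 0"
  shows "x \<in> \<nat> \<and> x \<ge> of_int B / 2"
proof -
  obtain c where c: "d = 2 * c" using \<open>even d\<close> by (elim evenE)
  with assms have "c \<ge> 0" "x = of_int c" by auto
  moreover have "x \<ge> of_int B / 2" using assms by simp
  ultimately show ?thesis using of_nat_nat[of c]
    by (metis of_int_of_nat_eq of_nat_in_Nats)
qed

lemma exponent_lhs1:
  assumes "(k, m) \<in> {0..} \<times> {0..} \<union> {..<0} \<times> {..<0}"
  shows "k^2/2 + m^2/2 + 4*k*m + k/2 + 3*m/2 \<in> \<nat> \<and>
         k^2/2 + m^2/2 + 4*k*m + k/2 + 3*m/2 \<ge> of_int (\<bar>k\<bar> + \<bar>m\<bar>) / 2"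
proof (rule Nats_bound_from_int)
  show "k^2/2 + m^2/2 + 4*k*m + k/2 + 3*m/2 = of_int (k*k + m*m + 8*(k*m) + k + 3*m) / 2"
    by (simp add: field_simps power2_eq_square)
  show "even (k*k + m*m + 8*(k*m) + k + 3*m)" by auto
  show "k*k + m*m + 8*(k*m) + k + 3*m \<ge> \<bar>k\<bar> + \<bar>m\<bar>"
    using assms by (cases rule: quadrant_cases) linarith+
qed auto

lemma exponent_rhs1:
  assumes "(k, m) \<in> {0..} \<times> {0..} \<union> {..<0} \<times> {..<0}"
  shows "3*k^2 + m^2/2 + 4*k*m + k + m/2 \<in> \<nat> \<and>
         3*k^2 + m^2/2 + 4*k*m + k + m/2 \<ge> of_int (\<bar>k\<bar> + \<bar>m\<bar>) / 2"
proof (rule Nats_bound_from_int)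
  show "3*k^2 + m^2/2 + 4*k*m + k + m/2 = of_int (6*(k*k) + m*m + 8*(k*m) + 2*k + m) / 2"
    by (simp add: field_simps power2_eq_square)
  show "even (6*(k*k) + m*m + 8*(k*m) + 2*k + m)" by auto
  show "6*(k*k) + m*m + 8*(k*m) + 2*k + m \<ge> \<bar>k\<bar> + \<bar>m\<bar>"
    using assms by (cases rule: quadrant_cases) linarith+
qed auto

lemma exponent_lhs2:
  assumes "(k, m) \<in> {0..} \<times> {0..} \<union> {..<0} \<times> {..<0}"
  shows "k^2/2 + m^2/2 + 4*k*m + 3*k/2 + 5*m/2 \<in> \<nat> \<and>
         k^2/2 + m^2/2 + 4*k*m + 3*k/2 + 5*m/2 \<ge> of_int (\<bar>k\<bar> + \<bar>m\<bar>) / 2"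
proof (rule Nats_bound_from_int)
  show "k^2/2 + m^2/2 + 4*k*m + 3*k/2 + 5*m/2 = of_int (k*k + m*m + 8*(k*m) + 3*k + 5*m) / 2"
    by (simp add: field_simps power2_eq_square)
  show "even (k*k + m*m + 8*(k*m) + 3*k + 5*m)" by auto
  show "k*k + m*m + 8*(k*m) + 3*k + 5*m \<ge> \<bar>k\<bar> + \<bar>m\<bar>"
    using assms by (cases rule: quadrant_cases) linarith+
qed auto

lemma exponent_rhs2:
  assumes "(k, m) \<in> {0..} \<times> {0..} \<union> {..<0} \<times> {..<0}"
  shows "3*k^2 + m^2/2 + 4*k*m + 3*k + 3*m/2 \<in> \<nat> \<and>
         3*k^2 + m^2/2 + 4*k*m + 3*k + 3*m/2 \<ge> of_int (\<bar>k\<bar> + \<bar>m\<bar>) / 2"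
proof (rule Nats_bound_from_int)
  show "3*k^2 + m^2/2 + 4*k*m + 3*k + 3*m/2 = of_int (6*(k*k) + m*m + 8*(k*m) + 6*k + 3*m) / 2"
    by (simp add: field_simps power2_eq_square)
  show "even (6*(k*k) + m*m + 8*(k*m) + 6*k + 3*m)" by auto
  show "6*(k*k) + m*m + 8*(k*m) + 6*k + 3*m \<ge> \<bar>k\<bar> + \<bar>m\<bar>"
    using assms by (cases rule: quadrant_cases) linarith+
qed auto

lemma fps_summable_onI:
  fixes f :: "'a \<Rightarrow> 'b :: ab_group_add fps"
  assumes fin: "\<And>n. finite {x \<in> A. fps_nth (f x) n \<noteq> 0}"
  shows "f summable_on A"
proof -
  define T where "T n = {x \<in> A. fps_nth (f x) n \<noteq> 0}" for n
  define g where "g = Abs_fps (\<lambda>n. \<Sum>x\<in>T n. fps_nth (f x) n)"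
  have "(f has_sum g) A"
    unfolding has_sum_def
  proof (rule tendsto_fpsI)
    fix n
    have "\<forall>\<^sub>F F in finite_subsets_at_top A. finite F \<and> T n \<subseteq> F \<and> F \<subseteq> A"
      using fin[of n] by (auto simp: eventually_finite_subsets_at_top T_def)
    then show "\<forall>\<^sub>F F in finite_subsets_at_top A. fps_nth (sum f F) n = fps_nth g n"
    proof eventually_elim
      case (elim F)
      have "(\<Sum>x\<in>F. fps_nth (f x) n) = (\<Sum>x\<in>T n. fps_nth (f x) n)"
        using elim by (intro sum.mono_neutral_right) (auto simp: T_def)
      then show ?case by (simp add: g_def fps_sum_nth)
    qed
  qed
  then show ?thesis by (auto simp: summable_on_def)
qed

lemma summable_q_pow:
  fixes e :: "int \<Rightarrow> int \<Rightarrow> real" and s :: "int \<Rightarrow> int \<Rightarrow> nat"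
  assumes "\<And>k m. (k, m) \<in> A \<Longrightarrow> e k m \<ge> of_int (\<bar>k\<bar> + \<bar>m\<bar>) / 2"
  shows "(\<lambda>(k, m). (-1) ^ s k m * q_pow (e k m)) summable_on A"
proof (rule fps_summable_onI)
  fix n :: nat
  have sgn: "(-1) ^ j = (fps_const ((-1) ^ j) :: int fps)" for j
    by (simp add: fps_const_neg flip: fps_const_power)
  have "{x \<in> A. fps_nth (case x of (k, m) \<Rightarrow> (-1) ^ s k m * q_pow (e k m)) n \<noteq> 0}
          \<subseteq> {- 2 * int n - 2 .. 2 * int n + 2} \<times> {- 2 * int n - 2 .. 2 * int n + 2}"
  proof clarify
    fix k m assume km: "(k, m) \<in> A"
      and "fps_nth ((-1) ^ s k m * q_pow (e k m)) n \<noteq> 0"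
    then have "n = nat \<lfloor>e k m\<rfloor>"
      by (simp add: q_pow_def sgn fps_X_power_iff split: if_splits)
    then have "e k m < n + 1" by linarith
    with assms[OF km] have "real_of_int (\<bar>k\<bar> + \<bar>m\<bar>) < real_of_int (2 * int n + 2)" by simp
    then have "\<bar>k\<bar> + \<bar>m\<bar> < 2 * int n + 2" by (simp only: of_int_less_iff)
    then show "k \<in> {- 2 * int n - 2 .. 2 * int n + 2} \<and> m \<in> {- 2 * int n - 2 .. 2 * int n + 2}"
      by auto
  qed
  then show "finite {x \<in> A. fps_nth (case x of (k, m) \<Rightarrow> (-1) ^ s k m * q_pow (e k m)) n \<noteq> 0}"
    by (rule finite_subset) auto
qed

lemma summable_lhs1:
  assumes "A \<in> {{0..} \<times> {0..}, {..<0} \<times> {..<0}}"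
  shows "(\<lambda>(k, m). (-1) ^ nat \<bar>m\<bar> * q_pow (k^2/2 + m^2/2 + 4*k*m + k/2 + 3*m/2))
           summable_on same_parity \<inter> A"
  by (rule summable_q_pow) (rule exponent_lhs1[THEN conjunct2], use assms in auto)

lemma summable_rhs1:
  assumes "A \<in> {{0..} \<times> {0..}, {..<0} \<times> {..<0}}"
  shows "(\<lambda>(k, m). (-1) ^ nat \<bar>k + m\<bar> * q_pow (3*k^2 + m^2/2 + 4*k*m + k + m/2))
           summable_on UNIV \<inter> A"
proof (rule summable_q_pow)
  fix k m assume "(k, m) \<in> UNIV \<inter> A"
  with assms have "(k, m) \<in> {0..} \<times> {0..} \<union> {..<0} \<times> {..<0}" by auto
  from exponent_rhs1[OF this] show "of_int (\<bar>k\<bar> + \<bar>m\<bar>) / 2 \<le> 3*(real_of_int k)^2 + (real_of_int m)^2/2 + 4*real_of_int k*real_of_int m + real_of_int k + real_of_int m/2" by simp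
qed

lemma summable_lhs2:
  assumes "A \<in> {{0..} \<times> {0..}, {..<0} \<times> {..<0}}"
  shows "(\<lambda>(k, m). (-1) ^ nat \<bar>m\<bar> * q_pow (k^2/2 + m^2/2 + 4*k*m + 3*k/2 + 5*m/2))
           summable_on same_parity \<inter> A"
  by (rule summable_q_pow) (rule exponent_lhs2[THEN conjunct2], use assms in auto)

lemma summable_rhs2:
  assumes "A \<in> {{0..} \<times> {0..}, {..<0} \<times> {..<0}}"
  shows "(\<lambda>(k, m). (-1) ^ nat \<bar>k + m\<bar> * q_pow (3*k^2 + m^2/2 + 4*k*m + 3*k + 3*m/2))
           summable_on UNIV \<inter> A"
proof (rule summable_q_pow)
  fix k m assume "(k, m) \<in> UNIV \<inter> A"
  with assms have "(k, m) \<in> {0..} \<times> {0..} \<union> {..<0} \<times> {..<0}" by auto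
  from exponent_rhs2[OF this] show "of_int (\<bar>k\<bar> + \<bar>m\<bar>) / 2 \<le> 3*(real_of_int k)^2 + (real_of_int m)^2/2 + 4*real_of_int k*real_of_int m + 3*real_of_int k + 3*real_of_int m/2" by simp
qed

lemma has_prod_one_plus_q:
  "(\<lambda>n. 1 + fps_X ^ Suc n :: int fps) has_prod (\<Prod>n. 1 + fps_X ^ Suc n)"
proof -
  let ?f = "\<lambda>n. 1 + fps_X ^ Suc n :: int fps"
  have nth0: "fps_nth (?f n) 0 = 1" for n by simp
  then have nz: "?f n \<noteq> 0" for n by (metis fps_zero_nth zero_neq_one)
  have "subdegree (?f k - 1) > n" if "k > n" for n k
    using that by simp
  then obtain P where P: "(\<lambda>n. \<Prod>k\<le>n. ?f k) \<longlonglongrightarrow> P"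
    using tendsto_prod_fps[of ?f "\<lambda>n. n"] nz by blast
  have "fps_nth P 0 = 1"
  proof -
    have *: "fps_nth (\<Prod>k\<le>n. ?f k) 0 = 1" for n
      by (induction n) simp_all
    from P have "\<forall>\<^sub>F n in sequentially. fps_nth (\<Prod>k\<le>n. ?f k) 0 = fps_nth P 0"
      unfolding tendsto_fps_iff by blast
    then have "\<forall>\<^sub>F n::nat in sequentially. 1 = fps_nth P 0"
      unfolding * .
    then show ?thesis by simp
  qed
  then have "P \<noteq> 0" by auto
  with P have "?f has_prod P" by (simp add: has_prod_def raw_has_prod_def)
  with has_prod_unique[OF this] show ?thesis by simp
qed

end

theory Submission
  imports Defs
begin

text \<open>
  Multiplied by \<open>\<Phi> = \<Sum>\<^bsub>n\<^esub> (-1)\<^sup>n q\<^bsup>3n\<^sup>2+n\<^esup>\<close>, the left-hand double sum becomes a sum over a rank three lattice with a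
  quadratic form of signature \<open>(2, 1)\<close>; multiplied by Ramanujan's \<open>\<psi>\<close>, so does the right-hand one, and
  \<open>\<psi> = \<Phi> \<Prod>(1 + q\<^sup>n)\<close>. In coordinates with exponent
  \<open>x(x+1)/2 + z(z+1)/2 - 5k\<^sup>2 - (2a+1)k - a\<close> (\<open>a = 0, 1\<close> for the two identities) both sums run over vectors with
  \<open>x \<equiv> z (mod 2)\<close> and differ only in the cones by which they are cut out. The cones are compared by
  automorphisms of the lattice that preserve the exponent: a summand that changes sign under such an
  automorphism contributes nothing. The reflection \<open>\<tau>\<close> replaces one wall of the right-hand cone by the wall
  \<open>p = 1/2\<close>; the involution \<open>\<kappa>\<close> maps \<open>p\<close> to \<open>1 - p\<close> and the other wall \<open>w\<close> to a wall of the left-hand cone; and the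
  reflection \<open>\<rho>\<close> removes the one residue class of \<open>w\<close> modulo 3 that does not occur on the left.
\<close>

section \<open>Formal series indexed by a set with weights and exponents\<close>

text \<open>The series \<Sum> c(v) q^(e(v)) over all v. It has this meaning only under
  \<open>admissible\<close>: a term of negative exponent is dropped, and a coefficient with
  infinitely many contributing indices becomes 0.\<close>

definition ser :: "('a \<Rightarrow> int) \<Rightarrow> ('a \<Rightarrow> int) \<Rightarrow> int fps" where
  "ser c e = Abs_fps (\<lambda>n. \<Sum>v | c v \<noteq> 0 \<and> e v = int n. c v)"

definition admissible :: "('a \<Rightarrow> int) \<Rightarrow> ('a \<Rightarrow> int) \<Rightarrow> bool" where
  "admissible c e \<longleftrightarrow> (\<forall>v. c v \<noteq> 0 \<longrightarrow> 0 \<le> e v) \<and> (\<forall>n. finite {v. c v \<noteq> 0 \<and> e v = int n})"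

lemma ser_nth: "fps_nth (ser c e) n = (\<Sum>v | c v \<noteq> 0 \<and> e v = int n. c v)"
  by (simp add: ser_def)

lemma ser_nth_superset:
  assumes "finite T" "{v. c v \<noteq> 0 \<and> e v = int n} \<subseteq> T" "\<And>v. v \<in> T \<Longrightarrow> e v = int n"
  shows "fps_nth (ser c e) n = sum c T"
  unfolding ser_nth using assms by (intro sum.mono_neutral_left) auto

lemma ser_uminus: "ser (\<lambda>v. - c v) e = - ser c e"
  by (simp add: fps_eq_iff ser_nth sum_negf)

lemma ser_add:
  assumes "admissible c e" "admissible d e"
  shows "ser (\<lambda>v. c v + d v) e = ser c e + ser d e"
proof (rule fps_ext)
  fix n
  define T where "T = {v. c v \<noteq> 0 \<and> e v = int n} \<union> {v. d v \<noteq> 0 \<and> e v = int n}"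
  have fin: "finite T" using assms by (simp add: T_def admissible_def)
  have "fps_nth (ser (\<lambda>v. c v + d v) e) n = (\<Sum>v\<in>T. c v + d v)"
    by (rule ser_nth_superset[OF fin]) (auto simp: T_def)
  moreover have "fps_nth (ser c e) n = sum c T"
    by (rule ser_nth_superset[OF fin]) (auto simp: T_def)
  moreover have "fps_nth (ser d e) n = sum d T"
    by (rule ser_nth_superset[OF fin]) (auto simp: T_def)
  ultimately show "fps_nth (ser (\<lambda>v. c v + d v) e) n = fps_nth (ser c e + ser d e) n"
    by (simp add: sum.distrib)
qed

lemma admissible_uminus: "admissible c e \<Longrightarrow> admissible (\<lambda>v. - c v) e"
  by (simp add: admissible_def)

lemma ser_diff:
  assumes "admissible c e" "admissible d e"
  shows "ser (\<lambda>v. c v - d v) e = ser c e - ser d e"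
  using ser_add[OF assms(1) admissible_uminus[OF assms(2)]] by (simp add: ser_uminus)

lemma admissible_mono:
  assumes "admissible c e" "\<And>v. d v \<noteq> 0 \<Longrightarrow> c v \<noteq> 0"
  shows "admissible d e"
proof -
  have "finite {v. d v \<noteq> 0 \<and> e v = int n}" for n
    by (rule finite_subset[of _ "{v. c v \<noteq> 0 \<and> e v = int n}"])
       (use assms in \<open>auto simp: admissible_def\<close>)
  with assms show ?thesis by (auto simp: admissible_def)
qed

lemma ser_reindex:
  assumes inj: "inj_on h {u. c u \<noteq> 0}"
    and supp: "\<And>v. d v \<noteq> 0 \<Longrightarrow> \<exists>u. c u \<noteq> 0 \<and> h u = v"
    and coef: "\<And>u. c u \<noteq> 0 \<Longrightarrow> d (h u) = c u"
    and expo: "\<And>u. c u \<noteq> 0 \<Longrightarrow> f (h u) = e u"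
  shows "ser d f = ser c e"
proof (rule fps_ext)
  fix n
  have "{v. d v \<noteq> 0 \<and> f v = int n} = h ` {u. c u \<noteq> 0 \<and> e u = int n}"
  proof (intro equalityI subsetI)
    fix v assume "v \<in> {v. d v \<noteq> 0 \<and> f v = int n}"
    with supp[of v] expo show "v \<in> h ` {u. c u \<noteq> 0 \<and> e u = int n}" by auto
  qed (auto simp: coef expo)
  moreover have "inj_on h {u. c u \<noteq> 0 \<and> e u = int n}"
    by (rule inj_on_subset[OF inj]) auto
  ultimately show "fps_nth (ser d f) n = fps_nth (ser c e) n"
    by (simp add: ser_nth sum.reindex coef)
qed

lemma ser_involution:
  assumes "\<And>v. h (h v) = v" "\<And>v. e (h v) = e v"
  shows "ser (\<lambda>v. c (h v)) e = ser c e"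
proof -
  have "inj h" by (rule inj_on_inverseI[of _ h]) (simp add: assms)
  then have "inj_on h {u. c u \<noteq> 0}" by (rule inj_on_subset) simp
  then show ?thesis
    by (rule ser_reindex) (use assms in \<open>metis\<close>)+
qed

text \<open>\<open>h\<close> pairs terms of equal exponent and opposite sign, so the series equals
  its own negative. The conditions concern the support only, since \<open>\<rho>\<close> is
  controlled on a single residue class (\<open>\<rho>_props\<close>).\<close>

lemma ser_antisymmetric:
  assumes "\<And>v. c v \<noteq> 0 \<Longrightarrow> h (h v) = v \<and> e (h v) = e v \<and> c (h v) = - c v"
  shows "ser c e = 0"
proof -
  have "inj_on h {u. - c u \<noteq> 0}"
    by (rule inj_on_inverseI[of _ h]) (use assms in auto)
  then have "ser c e = ser (\<lambda>v. - c v) e"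
  proof (rule ser_reindex)
    fix v assume "c v \<noteq> 0"
    with assms have "- c (h v) \<noteq> 0 \<and> h (h v) = v" by auto
    then show "\<exists>u. - c u \<noteq> 0 \<and> h u = v" by blast
  qed (use assms in auto)
  then show ?thesis by (simp add: ser_uminus fps_eq_iff)
qed

lemma admissible_involution:
  assumes "admissible c e" "\<And>v. h (h v) = v" "\<And>v. e (h v) = e v"
  shows "admissible (\<lambda>v. c (h v)) e"
proof -
  have "{v. c (h v) \<noteq> 0 \<and> e v = int n} = h ` {v. c v \<noteq> 0 \<and> e v = int n}" for n
  proof (intro equalityI subsetI)
    fix v assume "v \<in> {v. c (h v) \<noteq> 0 \<and> e v = int n}"
    then show "v \<in> h ` {v. c v \<noteq> 0 \<and> e v = int n}"
      using assms(2,3) by (intro image_eqI[of _ _ "h v"]) auto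
  qed (use assms in auto)
  moreover have "0 \<le> e v" if "c (h v) \<noteq> 0" for v
    using that assms(1,3) unfolding admissible_def by metis
  ultimately show ?thesis using assms(1) by (simp add: admissible_def)
qed

text \<open>Since both exponents are nonnegative, the pairs of total exponent n split into the
  finite blocks \<open>A i \<times> B (n - i)\<close> with i \<le> n, which is the Cauchy
  product.\<close>

lemma ser_mult:
  fixes c :: "'a \<Rightarrow> int" and d :: "'b \<Rightarrow> int"
  assumes "admissible c e" "admissible d f"
  shows "ser c e * ser d f = ser (\<lambda>(u, v). c u * d v) (\<lambda>(u, v). e u + f v)"
proof (rule fps_ext)
  fix n
  define A where "A i = {u. c u \<noteq> 0 \<and> e u = int i}" for i
  define B where "B i = {v. d v \<noteq> 0 \<and> f v = int i}" for i
  have fin: "finite (A i)" "finite (B i)" for i using assms by (auto simp: A_def B_def admissible_def)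
  have "fps_nth (ser c e * ser d f) n = (\<Sum>i=0..n. sum c (A i) * sum d (B (n - i)))"
    by (simp add: fps_mult_nth ser_nth A_def B_def)
  also have "\<dots> = (\<Sum>i=0..n. \<Sum>p \<in> A i \<times> B (n - i). c (fst p) * d (snd p))"
    by (simp add: sum_product sum.cartesian_product case_prod_beta)
  also have "\<dots> = (\<Sum>p \<in> (\<Union>i\<in>{0..n}. A i \<times> B (n - i)). c (fst p) * d (snd p))"
    by (rule sum.UNION_disjoint[symmetric]) (use fin in \<open>auto simp: A_def\<close>)
  also have "(\<Union>i\<in>{0..n}. A i \<times> B (n - i))
      = {p. (case p of (u, v) \<Rightarrow> c u * d v) \<noteq> 0 \<and> (case p of (u, v) \<Rightarrow> e u + f v) = int n}"
    (is "?L = ?R")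
  proof (intro equalityI subsetI)
    fix p assume "p \<in> ?R"
    then obtain u v where p: "p = (u, v)" "c u \<noteq> 0" "d v \<noteq> 0" "e u + f v = int n"
      by (cases p) auto
    moreover from p assms have "0 \<le> e u" "0 \<le> f v" by (auto simp: admissible_def)
    ultimately have "u \<in> A (nat (e u))" "v \<in> B (n - nat (e u))" "nat (e u) \<in> {0..n}"
      by (auto simp: A_def B_def)
    with p show "p \<in> ?L" by blast
  qed (auto simp: A_def B_def)
  finally show "fps_nth (ser c e * ser d f) n
      = fps_nth (ser (\<lambda>(u, v). c u * d v) (\<lambda>(u, v). e u + f v)) n"
    by (simp add: ser_nth case_prod_beta)
qed

text \<open>Once a finite subset contains \<open>T\<close>, its coefficient of q^n no longer
  changes, so the finite sums converge coefficientwise.\<close>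

lemma infsum_fps:
  fixes f :: "'a \<Rightarrow> int fps"
  assumes fin: "\<And>n. finite {x \<in> A. fps_nth (f x) n \<noteq> 0}"
  shows "infsum f A = Abs_fps (\<lambda>n. \<Sum>x | x \<in> A \<and> fps_nth (f x) n \<noteq> 0. fps_nth (f x) n)"
    (is "_ = ?g")
proof (rule infsumI, unfold has_sum_def, rule tendsto_fpsI)
  fix n
  define T where "T = {x \<in> A. fps_nth (f x) n \<noteq> 0}"
  have "\<forall>\<^sub>F F in finite_subsets_at_top A. finite F \<and> T \<subseteq> F \<and> F \<subseteq> A"
    using fin[of n] by (auto simp: eventually_finite_subsets_at_top T_def)
  then show "\<forall>\<^sub>F F in finite_subsets_at_top A. fps_nth (sum f F) n = fps_nth ?g n"
  proof eventually_elim
    case (elim F)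
    have "(\<Sum>x\<in>F. fps_nth (f x) n) = (\<Sum>x\<in>T. fps_nth (f x) n)"
      using elim by (intro sum.mono_neutral_right) (auto simp: T_def)
    then show ?case by (simp add: T_def fps_sum_nth)
  qed
qed

section \<open>Cone sums as formal series\<close>

definition heaviside :: "int \<Rightarrow> int" where "heaviside t = (if 0 \<le> t then 1 else 0)"

text \<open>(-1)^t for integers t of either sign.\<close>

definition parity_sign :: "int \<Rightarrow> int" where "parity_sign t = (if even t then 1 else -1)"

lemma power_nat_abs_eq_parity_sign: "(-1) ^ nat \<bar>t\<bar> = parity_sign t"
  by (auto simp: parity_sign_def even_nat_iff)

text \<open>\<open>heaviside k + heaviside m - 1\<close> is 1 where k, m \<ge> 0, -1 where k, m < 0,
  and 0 on the mixed quadrants, so the difference of the two sums is a single series over all pairs.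
  The bound on |k| + |m| leaves finitely many pairs for each exponent.\<close>

lemma indef_sum_eq_ser:
  fixes e :: "int \<Rightarrow> int \<Rightarrow> real" and s :: "int \<Rightarrow> int \<Rightarrow> int" and S :: "(int \<times> int) set"
  defines "c \<equiv> \<lambda>(k, m). if (k, m) \<in> S then (heaviside k + heaviside m - 1) * parity_sign (s k m) else 0"
  assumes e: "\<And>k m. (k, m) \<in> {0..} \<times> {0..} \<union> {..<0} \<times> {..<0} \<Longrightarrow>
               e k m = real_of_int (d (k, m)) \<and> \<bar>k\<bar> + \<bar>m\<bar> \<le> 2 * d (k, m)"
  shows "indef_sum S (\<lambda>k m. (-1) ^ nat \<bar>s k m\<bar> * q_pow (e k m)) = ser c d" and "admissible c d"
proof -
  define f where "f = (\<lambda>(k, m). (-1) ^ nat \<bar>s k m\<bar> * q_pow (e k m))"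
  define Q where "Q = ({0..} \<times> {0..} \<union> {..<0} \<times> {..<0} :: (int \<times> int) set)"
  define \<sigma> where "\<sigma> = (\<lambda>(k, m). parity_sign (s k m))"
  define \<gamma> where "\<gamma> A p = (if p \<in> A then \<sigma> p else 0)" for A p
  have \<sigma>: "\<sigma> p \<noteq> 0" for p by (simp add: \<sigma>_def parity_sign_def split: prod.split)
  have nth: "fps_nth (f p) n = (if d p = int n then \<sigma> p else 0)" if "p \<in> Q" for p n
  proof -
    obtain k m where p: "p = (k, m)" by force
    have *: "e k m = real_of_int (d (k, m))" "0 \<le> d (k, m)"
      using e[of k m] that by (auto simp: Q_def p)
    have "(-1) ^ j = (fps_const ((-1) ^ j) :: int fps)" for j
      by (metis fps_const_1_eq_1 fps_const_neg fps_const_power)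
    then have "f p = fps_const (\<sigma> p) * fps_X ^ nat (d p)"
      using * by (simp add: f_def \<sigma>_def p q_pow_def power_nat_abs_eq_parity_sign)
    then show ?thesis using * by (auto simp: p fps_X_power_iff)
  qed
  have bound: "0 \<le> d p \<and> \<bar>fst p\<bar> + \<bar>snd p\<bar> \<le> 2 * d p" if "p \<in> Q" for p
    using e[of "fst p" "snd p"] that by (auto simp: Q_def)
  have fin: "finite {p \<in> Q. d p = int n}" for n
  proof (rule finite_subset)
    show "{p \<in> Q. d p = int n} \<subseteq> {- 2 * int n .. 2 * int n} \<times> {- 2 * int n .. 2 * int n}"
    proof
      fix p assume "p \<in> {p \<in> Q. d p = int n}"
      with bound[of p] show "p \<in> {- 2 * int n .. 2 * int n} \<times> {- 2 * int n .. 2 * int n}"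
        by (cases p) auto
    qed
  qed simp
  have adm: "admissible c' d" if "\<And>p. c' p \<noteq> 0 \<Longrightarrow> p \<in> Q" for c'
  proof -
    have "finite {p. c' p \<noteq> 0 \<and> d p = int n}" for n
      by (rule finite_subset[OF _ fin[of n]]) (use that in blast)
    then show ?thesis using that bound unfolding admissible_def by blast
  qed
  have adm': "admissible (\<gamma> (S \<inter> A)) d" if "A \<subseteq> Q" for A
  proof (rule adm)
    fix p assume "\<gamma> (S \<inter> A) p \<noteq> 0"
    then have "p \<in> S \<inter> A" by (metis \<gamma>_def)
    with that show "p \<in> Q" by blast
  qed
  have *: "infsum f (S \<inter> A) = ser (\<gamma> (S \<inter> A)) d" if A: "A \<subseteq> Q" for A
  proof -
    have eq: "p \<in> S \<inter> A \<and> fps_nth (f p) n \<noteq> 0 \<longleftrightarrow> \<gamma> (S \<inter> A) p \<noteq> 0 \<and> d p = int n" for p n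
    proof (cases "p \<in> S \<inter> A")
      case True
      with A have "p \<in> Q" by blast
      with True show ?thesis by (simp add: nth \<gamma>_def \<sigma>)
    qed (auto simp: \<gamma>_def)
    have "finite {p \<in> S \<inter> A. fps_nth (f p) n \<noteq> 0}" for n
    proof (rule finite_subset[OF _ fin[of n]])
      show "{p \<in> S \<inter> A. fps_nth (f p) n \<noteq> 0} \<subseteq> {p \<in> Q. d p = int n}"
      proof
        fix p assume "p \<in> {p \<in> S \<inter> A. fps_nth (f p) n \<noteq> 0}"
        then have "p \<in> A" "d p = int n" using eq[of p n] by auto
        with A show "p \<in> {p \<in> Q. d p = int n}" by blast
      qed
    qed
    then have "infsum f (S \<inter> A)
        = Abs_fps (\<lambda>n. \<Sum>p | p \<in> S \<inter> A \<and> fps_nth (f p) n \<noteq> 0. fps_nth (f p) n)"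
      by (rule infsum_fps)
    also have "\<dots> = ser (\<gamma> (S \<inter> A)) d"
      unfolding ser_def eq
    proof (intro arg_cong[of _ _ Abs_fps] ext sum.cong refl)
      fix n p assume "p \<in> {p. \<gamma> (S \<inter> A) p \<noteq> 0 \<and> d p = int n}"
      then have "p \<in> S \<inter> A" "d p = int n" by (auto simp: \<gamma>_def split: if_splits)
      moreover from this A have "p \<in> Q" by blast
      ultimately show "fps_nth (f p) n = \<gamma> (S \<inter> A) p" by (simp add: nth \<gamma>_def)
    qed
    finally show ?thesis .
  qed
  have c: "c = (\<lambda>p. \<gamma> (S \<inter> {0..} \<times> {0..}) p - \<gamma> (S \<inter> {..<0} \<times> {..<0}) p)"
  proof
    fix p :: "int \<times> int"
    obtain k m where p: "p = (k, m)" by force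
    show "c p = \<gamma> (S \<inter> {0..} \<times> {0..}) p - \<gamma> (S \<inter> {..<0} \<times> {..<0}) p"
      by (simp add: p c_def \<gamma>_def \<sigma>_def heaviside_def)
  qed
  have "indef_sum S (\<lambda>k m. (-1) ^ nat \<bar>s k m\<bar> * q_pow (e k m))
      = infsum f (S \<inter> {0..} \<times> {0..}) - infsum f (S \<inter> {..<0} \<times> {..<0})"
    by (simp add: indef_sum_def f_def)
  also have "\<dots> = ser (\<gamma> (S \<inter> {0..} \<times> {0..})) d - ser (\<gamma> (S \<inter> {..<0} \<times> {..<0})) d"
    by (simp add: * Q_def)
  also have "\<dots> = ser c d"
    unfolding c by (rule ser_diff[symmetric, OF adm' adm']) (auto simp: Q_def)
  finally show "indef_sum S (\<lambda>k m. (-1) ^ nat \<bar>s k m\<bar> * q_pow (e k m)) = ser c d" .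
  show "admissible c d"
  proof (rule adm)
    fix p assume "c p \<noteq> 0"
    then have "\<gamma> (S \<inter> {0..} \<times> {0..}) p \<noteq> 0 \<or> \<gamma> (S \<inter> {..<0} \<times> {..<0}) p \<noteq> 0"
      unfolding c by auto
    then show "p \<in> Q" unfolding Q_def \<gamma>_def by (metis Int_iff UnCI)
  qed
qed

section \<open>The identities of Euler and Gauss\<close>

lemma prod_greaterThanAtMost_head:
  fixes f :: "nat \<Rightarrow> 'a :: comm_monoid_mult"
  assumes "s < n"
  shows "prod f {s<..n} = f (Suc s) * prod f {Suc s<..n}"
proof -
  have "{s<..n} = insert (Suc s) {Suc s<..n}" using assms by auto
  then show ?thesis by simp
qed

lemma prod_greaterThanAtMost_Suc:
  fixes f :: "nat \<Rightarrow> 'a :: comm_monoid_mult"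
  assumes "s \<le> n"
  shows "prod f {s<..Suc n} = prod f {s<..n} * f (Suc n)"
proof -
  have "{s<..Suc n} = insert (Suc n) {s<..n}" using assms by auto
  then show ?thesis by (simp add: mult.commute)
qed

text \<open>
  Shanks' finite forms of the pentagonal number theorem (at \<open>y\<^sup>2\<close>) and of Gauss's triangular number
  identity. Up to high powers of \<open>y\<close>, only the summand \<open>s = 0\<close> of the sums with products survives.
\<close>

lemma shanks_pentagonal:
  fixes y :: "'a :: comm_ring_1"
  shows "(\<Sum>s\<le>n. (-1) ^ s * (\<Prod>j\<in>{s<..n}. 1 - y ^ (2 * j)) * y ^ (2 * s * n + s * (s + 1)))
       = 1 + (\<Sum>m\<in>{1..n}. (-1) ^ m * (y ^ (m * (3 * m - 1)) + y ^ (m * (3 * m + 1))))"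
proof (induction n)
  case (Suc n)
  define t where "t N s = (-1) ^ s * (\<Prod>j\<in>{s<..N}. 1 - y ^ (2 * j)) * y ^ (2 * s * N + s * (s + 1))"
    for N s
  \<comment> \<open>Writing y^(2s) (1 - y^(2n+2)) as 1 - (1 - y^(2s)) - y^(2s+2n+2) leaves
    corrections that telescope by \<open>shift\<close>; the weight 1 - y^(2s) makes
    \<open>u 0 = 0\<close>.\<close>
  define u where "u s = t n s * (1 - y ^ (2 * s))" for s
  have step: "t (Suc n) s = t n s - u s - t n s * y ^ (2 * s + 2 * Suc n)" if "s \<le> n" for s
  proof -
    have "y ^ (2 * s * Suc n + s * (s + 1)) = y ^ (2 * s * n + s * (s + 1)) * y ^ (2 * s)"
      by (simp add: algebra_simps flip: power_add)
    moreover have "(\<Prod>j\<in>{s<..Suc n}. 1 - y ^ (2 * j)) = (\<Prod>j\<in>{s<..n}. 1 - y ^ (2 * j)) * (1 - y ^ (2 * Suc n))"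
      using that by (rule prod_greaterThanAtMost_Suc)
    ultimately have "t (Suc n) s = t n s * (y ^ (2 * s) * (1 - y ^ (2 * Suc n)))"
      by (simp only: t_def mult_ac)
    then show ?thesis
      by (simp add: u_def power_add right_diff_distrib mult.assoc)
  qed
  have shift: "t n s * y ^ (2 * s + 2 * Suc n) = - u (Suc s)" if "s < n" for s
  proof -
    have *: "(\<Prod>j\<in>{s<..n}. 1 - y ^ (2 * j)) = (1 - y ^ (2 * Suc s)) * (\<Prod>j\<in>{Suc s<..n}. 1 - y ^ (2 * j))"
      using that by (rule prod_greaterThanAtMost_head)
    have **: "y ^ (2 * Suc s * n + Suc s * (Suc s + 1))
        = y ^ (2 * s * n + s * (s + 1)) * y ^ (2 * s + 2 * Suc n)"
      by (simp add: algebra_simps flip: power_add)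
    have "\<sigma> * (D * R) * A * B = - (- 1 * \<sigma> * R * (A * B) * D)" for A B D R \<sigma> :: 'a
      by (simp add: algebra_simps)
    then show ?thesis
      by (simp only: t_def u_def * ** power_Suc[of "-1"])
  qed
  have "(\<Sum>s\<le>n. t (Suc n) s) = (\<Sum>s\<le>n. t n s) - (\<Sum>s\<le>n. u s + t n s * y ^ (2 * s + 2 * Suc n))"
    by (simp add: step sum_subtractf sum.distrib)
  also have "(\<Sum>s\<le>n. u s + t n s * y ^ (2 * s + 2 * Suc n))
      = (\<Sum>s<n. u s - u (Suc s)) + (u n + t n n * y ^ (2 * n + 2 * Suc n))"
  proof -
    have "u s + t n s * y ^ (2 * s + 2 * Suc n) = u s - u (Suc s)" if "s < n" for s
      using shift[OF that] by (simp only: diff_conv_add_uminus)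
    then have "(\<Sum>s<n. u s + t n s * y ^ (2 * s + 2 * Suc n)) = (\<Sum>s<n. u s - u (Suc s))"
      by (intro sum.cong) auto
    then show ?thesis
      by (simp only: sum.lessThan_Suc flip: lessThan_Suc_atMost)
  qed
  also have "(\<Sum>s<n. u s - u (Suc s)) = - u n"
    unfolding sum_lessThan_telescope' by (simp add: u_def)
  finally have "(\<Sum>s\<le>Suc n. t (Suc n) s)
      = (\<Sum>s\<le>n. t n s) - t n n * y ^ (2 * n + 2 * Suc n) + t (Suc n) (Suc n)"
    by simp
  \<comment> \<open>The leftover at s = n and the new summand s = n + 1 are the two pentagonal terms
    for m = n + 1.\<close>
  also have "t n n * y ^ (2 * n + 2 * Suc n) = - ((-1) ^ Suc n * y ^ (Suc n * (3 * Suc n - 1)))"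
    by (simp add: t_def algebra_simps flip: power_add)
  also have "t (Suc n) (Suc n) = (-1) ^ Suc n * y ^ (Suc n * (3 * Suc n + 1))"
  proof -
    have "2 * Suc n * Suc n + Suc n * (Suc n + 1) = Suc n * (3 * Suc n + 1)"
      by (simp add: algebra_simps)
    moreover have "(\<Prod>j\<in>{Suc n<..Suc n}. 1 - y ^ (2 * j)) = 1" by simp
    ultimately show ?thesis by (simp only: t_def mult_1_right)
  qed
  finally show ?case
    using Suc.IH by (simp add: t_def algebra_simps)
qed simp

lemma shanks_triangular:
  fixes y :: "'a :: comm_ring_1"
  shows "(\<Prod>j<n. 1 - y ^ (2 * j + 1)) * (\<Sum>s<2 * n. y ^ (s * (s + 1) div 2))
       = (\<Sum>s<n. (\<Prod>j\<in>{s<..n}. 1 - y ^ (2 * j)) * (\<Prod>j<s. 1 - y ^ (2 * j + 1)) * y ^ (s * (2 * n + 1)))"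
proof (induction n)
  case (Suc n)
  define O' where "O' s = (\<Prod>j<s. 1 - y ^ (2 * j + 1))" for s
  define R where "R N s = (\<Prod>j\<in>{s<..N}. 1 - y ^ (2 * j))" for N s
  define b where "b s = R n s * O' s * y ^ (s * (2 * n + 1))" for s
  \<comment> \<open>As before \<open>u\<close> carries the telescoping part. The splitting now also
    leaves 1 - y^(2n+1), the factor that extends the odd product to n + 1.\<close>
  define u where "u s = b s * (1 - y ^ (2 * s))" for s
  have step: "R (Suc n) s * O' s * y ^ (s * (2 * Suc n + 1))
      = b s * (1 - y ^ (2 * n + 1)) - u s + b s * (1 - y ^ (2 * s + 1)) * y ^ (2 * n + 1)" if "s < n" for s
  proof -
    have "y ^ (s * (2 * Suc n + 1)) = y ^ (s * (2 * n + 1)) * y ^ (2 * s)"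
      by (simp add: algebra_simps flip: power_add)
    moreover have "R (Suc n) s = R n s * (1 - y ^ (2 * Suc n))"
      using that by (simp add: R_def prod_greaterThanAtMost_Suc)
    ultimately have *: "R (Suc n) s * O' s * y ^ (s * (2 * Suc n + 1))
        = b s * (y ^ (2 * s) * (1 - y ^ (2 * Suc n)))"
      by (simp only: b_def mult_ac)
    have **: "y ^ (2 * s) * (1 - y ^ (2 * Suc n))
        = (1 - y ^ (2 * n + 1)) - (1 - y ^ (2 * s)) + (1 - y ^ (2 * s + 1)) * y ^ (2 * n + 1)"
      by (simp add: algebra_simps power_add)
    have "B * (A - D + C * Q) = B * A - B * D + B * C * Q" for A B C D Q :: 'a
      by (simp add: algebra_simps)
    then show ?thesis
      by (simp only: * ** u_def)
  qed
  have shift: "b s * (1 - y ^ (2 * s + 1)) * y ^ (2 * n + 1) = u (Suc s)" if "s < n" for s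
  proof -
    have "R n s = (1 - y ^ (2 * Suc s)) * R n (Suc s)"
      unfolding R_def using that by (rule prod_greaterThanAtMost_head)
    moreover have "O' (Suc s) = O' s * (1 - y ^ (2 * s + 1))" by (simp add: O'_def)
    moreover have "y ^ (Suc s * (2 * n + 1)) = y ^ (s * (2 * n + 1)) * y ^ (2 * n + 1)"
      by (simp add: algebra_simps flip: power_add power_Suc)
    ultimately show ?thesis unfolding b_def u_def by (simp only: mult_ac)
  qed
  have "(\<Sum>s<n. R (Suc n) s * O' s * y ^ (s * (2 * Suc n + 1)))
      = (\<Sum>s<n. b s) * (1 - y ^ (2 * n + 1)) + (\<Sum>s<n. u (Suc s) - u s)"
  proof -
    have "R (Suc n) s * O' s * y ^ (s * (2 * Suc n + 1)) = b s * (1 - y ^ (2 * n + 1)) + (u (Suc s) - u s)"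
      if "s < n" for s
      unfolding step[OF that] shift[OF that] by (rule diff_add_eq[THEN trans], rule add_diff_eq[symmetric])
    then have "(\<Sum>s<n. R (Suc n) s * O' s * y ^ (s * (2 * Suc n + 1)))
        = (\<Sum>s<n. b s * (1 - y ^ (2 * n + 1)) + (u (Suc s) - u s))"
      by (intro sum.cong) auto
    then show ?thesis
      by (simp only: sum.distrib sum_distrib_right)
  qed
  also have "(\<Sum>s<n. u (Suc s) - u s) = u n"
    unfolding sum_lessThan_telescope by (simp add: u_def)
  finally have "(\<Sum>s<Suc n. R (Suc n) s * O' s * y ^ (s * (2 * Suc n + 1)))
      = (\<Sum>s<n. b s) * (1 - y ^ (2 * n + 1)) + (u n + R (Suc n) n * O' n * y ^ (n * (2 * Suc n + 1)))"
    by simp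
  \<comment> \<open>The exponents n(2n+1) and (n+1)(2n+1) are the triangular numbers of 2n and 2n +
    1, the two terms that the sum on the left gains.\<close>
  also have "u n + R (Suc n) n * O' n * y ^ (n * (2 * Suc n + 1))
      = O' (Suc n) * (y ^ (n * (2 * n + 1)) + y ^ (n * (2 * n + 1) + (2 * n + 1)))"
  proof -
    define Y Q where "Y = y ^ (n * (2 * n + 1))" and "Q = y ^ (2 * n)"
    have eqs: "y ^ (n * (2 * Suc n + 1)) = Y * Q" "y ^ (n * (2 * n + 1) + (2 * n + 1)) = Y * (y * Q)"
        "y ^ (2 * n + 1) = y * Q" "R (Suc n) n = 1 - y * y * Q" "R n n = 1"
      by (simp_all add: Y_def Q_def R_def prod_greaterThanAtMost_Suc algebra_simps flip: power_add power_Suc)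
    have *: "O' (Suc n) = O' n * (1 - y * Q)" by (simp only: O'_def prod.lessThan_Suc eqs)
    show ?thesis
      unfolding eqs * u_def b_def Y_def[symmetric] Q_def[symmetric] by (simp add: algebra_simps)
  qed
  also have "(\<Sum>s<n. b s) = O' n * (\<Sum>s<2 * n. y ^ (s * (s + 1) div 2))"
    unfolding b_def R_def O'_def by (rule Suc.IH[symmetric])
  also have "O' n * (\<Sum>s<2 * n. y ^ (s * (s + 1) div 2)) * (1 - y ^ (2 * n + 1))
      = O' (Suc n) * (\<Sum>s<2 * n. y ^ (s * (s + 1) div 2))"
    by (simp add: O'_def mult_ac)
  also have "\<dots> + O' (Suc n) * (y ^ (n * (2 * n + 1)) + y ^ (n * (2 * n + 1) + (2 * n + 1)))
      = O' (Suc n) * (\<Sum>s<2 * Suc n. y ^ (s * (s + 1) div 2))"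
  proof -
    have "2 * n * (2 * n + 1) div 2 = n * (2 * n + 1)" by (simp add: mult.assoc)
    moreover have "Suc (2 * n) * (Suc (2 * n) + 1) = 2 * (n * (2 * n + 1) + (2 * n + 1))"
      by (simp add: algebra_simps)
    then have "Suc (2 * n) * (Suc (2 * n) + 1) div 2 = n * (2 * n + 1) + (2 * n + 1)" by simp
    moreover have "2 * Suc n = Suc (Suc (2 * n))" by simp
    ultimately show ?thesis by (simp only: sum.lessThan_Suc distrib_left add.assoc)
  qed
  finally show ?case by (simp only: R_def O'_def)
qed simp

section \<open>Congruence of power series modulo q^n\<close>

definition agree :: "nat \<Rightarrow> int fps \<Rightarrow> int fps \<Rightarrow> bool" where
  "agree n f g \<longleftrightarrow> (\<forall>i<n. fps_nth f i = fps_nth g i)"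

lemma agree_refl [simp]: "agree n f f"
  by (simp add: agree_def)

lemma agree_sym: "agree n f g \<Longrightarrow> agree n g f"
  by (simp add: agree_def)

lemma agree_trans [trans]: "agree n f g \<Longrightarrow> agree n g h \<Longrightarrow> agree n f h"
  by (simp add: agree_def)

lemma agree_mult: "agree n f f' \<Longrightarrow> agree n g g' \<Longrightarrow> agree n (f * g) (f' * g')"
  by (auto simp: agree_def fps_mult_nth intro!: sum.cong)

lemma agree_add: "agree n f f' \<Longrightarrow> agree n g g' \<Longrightarrow> agree n (f + g) (f' + g')"
  by (auto simp: agree_def)

lemma agree_sum: "(\<And>s. s \<in> S \<Longrightarrow> agree n (f s) (g s)) \<Longrightarrow> agree n (sum f S) (sum g S)"
  by (auto simp: agree_def fps_sum_nth intro!: sum.cong)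

lemma agree_X_power: "n \<le> N \<Longrightarrow> agree n (g * fps_X ^ N) 0"
  by (auto simp: agree_def fps_X_power_mult_right_nth)

lemma fps_eq_if_agree: "(\<And>n. agree n f g) \<Longrightarrow> f = g"
  by (rule fps_ext) (use agree_def in blast)

section \<open>The theta series \<open>Phi\<close> and \<open>psi\<close> and their infinite
  products\<close>

definition Phi :: "int fps" where
  "Phi = ser parity_sign (\<lambda>n. 3 * n * n + n)"

definition psi :: "int fps" where
  "psi = ser heaviside (\<lambda>n. n * (n + 1) div 2)"

lemma abs_le_pentagonal: "\<bar>n\<bar> \<le> 3 * n * n + (n :: int)"
proof (cases "n \<ge> 0")
  case False
  then have "n * n \<ge> - n" using mult_right_mono_neg[of n "-1" n] by simp
  with False show ?thesis by simp
qed simp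

lemma le_triangular: "n \<le> n * (n + 1) div 2" if "n \<ge> 0" for n :: int
proof -
  have "n * 2 \<le> n * (n + 1) \<or> n = 0" using that by (auto intro!: mult_left_mono)
  then show ?thesis by auto
qed

lemma admissible_Phi: "admissible parity_sign (\<lambda>n. 3 * n * n + n)"
proof -
  note * = abs_le_pentagonal
  have "finite {n. parity_sign n \<noteq> 0 \<and> 3 * n * n + n = int N}" for N
  proof (rule finite_subset)
    show "{n. parity_sign n \<noteq> 0 \<and> 3 * n * n + n = int N} \<subseteq> {- int N..int N}"
    proof
      fix n assume "n \<in> {n. parity_sign n \<noteq> 0 \<and> 3 * n * n + n = int N}"
      with *[of n] have "\<bar>n\<bar> \<le> int N" by simp
      then show "n \<in> {- int N..int N}" by auto
    qed
  qed simp
  moreover have "0 \<le> 3 * n * n + n" for n :: int using *[of n] by linarith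
  ultimately show ?thesis by (simp add: admissible_def)
qed

lemma admissible_psi: "admissible heaviside (\<lambda>n. n * (n + 1) div 2)"
proof -
  note * = le_triangular
  have "finite {n. heaviside n \<noteq> 0 \<and> n * (n + 1) div 2 = int N}" for N
    by (rule finite_subset[of _ "{0..int N}"]) (use * in \<open>force simp: heaviside_def split: if_splits\<close>)+
  moreover have "0 \<le> n * (n + 1) div 2" if "heaviside n \<noteq> 0" for n
    using * that by (force simp: heaviside_def split: if_splits)
  ultimately show ?thesis by (simp add: admissible_def)
qed

text \<open>Only indices of exponent below n matter, so any finite set containing them may serve as
  range of summation; nonnegative exponents keep \<open>nat\<close> faithful.\<close>

lemma agree_ser:
  assumes "finite T" "\<And>v. c v \<noteq> 0 \<Longrightarrow> e v < int n \<Longrightarrow> v \<in> T" "\<And>v. v \<in> T \<Longrightarrow> 0 \<le> e v"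
  shows "agree n (ser c e) (\<Sum>v\<in>T. fps_const (c v) * fps_X ^ nat (e v))"
  unfolding agree_def
proof (intro allI impI)
  fix i assume "i < n"
  have "fps_nth (\<Sum>v\<in>T. fps_const (c v) * fps_X ^ nat (e v)) i = (\<Sum>v\<in>T. if e v = int i then c v else 0)"
    unfolding fps_sum_nth
  proof (rule sum.cong)
    fix v assume "v \<in> T"
    then have "0 \<le> e v" by (rule assms(3))
    then show "fps_nth (fps_const (c v) * fps_X ^ nat (e v)) i = (if e v = int i then c v else 0)"
      by (auto simp: fps_X_power_iff)
  qed simp
  also have "\<dots> = sum c {v \<in> T. e v = int i}"
    by (simp only: sum.inter_filter[OF assms(1)])
  also have "\<dots> = fps_nth (ser c e) i"
    using assms(1,2) \<open>i < n\<close> by (intro ser_nth_superset[symmetric]) auto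
  finally show "fps_nth (ser c e) i = fps_nth (\<Sum>v\<in>T. fps_const (c v) * fps_X ^ nat (e v)) i" ..
qed

lemma sum_symmetric_interval:
  fixes f :: "int \<Rightarrow> 'a :: comm_monoid_add"
  shows "sum f {- int n..int n} = f 0 + (\<Sum>m\<in>{1..n}. f (- int m) + f (int m))"
proof (induction n)
  case (Suc n)
  have "{- int (Suc n)..int (Suc n)} = insert (- int (Suc n)) (insert (int (Suc n)) {- int n..int n})"
    by auto
  then show ?case by (simp add: Suc.IH add_ac)
qed simp

lemma Phi_partial:
  "agree n Phi (1 + (\<Sum>m\<in>{1..n}. (-1) ^ m * (fps_X ^ (m * (3 * m - 1)) + fps_X ^ (m * (3 * m + 1)))))"
proof -
  define f where "f k = fps_const (parity_sign k) * fps_X ^ nat (3 * k * k + k)" for k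
  have "agree n Phi (sum f {- int n..int n})"
    unfolding Phi_def f_def
  proof (rule agree_ser)
    show "k \<in> {- int n..int n}" if "3 * k * k + k < int n" for k
    proof -
      have "\<bar>k\<bar> < int n" using abs_le_pentagonal[of k] that by linarith
      then show ?thesis by auto
    qed
    show "0 \<le> 3 * k * k + k" for k :: int
      using abs_le_pentagonal[of k] by linarith
  qed simp
  moreover have "f (- int m) + f (int m) = (-1) ^ m * (fps_X ^ (m * (3 * m - 1)) + fps_X ^ (m * (3 * m + 1)))"
    if "m \<in> {1..n}" for m
  proof -
    have e: "3 * int m * int m + int m = int (m * (3 * m + 1))"
      "3 * (- int m) * (- int m) + (- int m) = int (m * (3 * m - 1))"
      using that by (simp_all add: algebra_simps of_nat_diff)
    have "fps_const (parity_sign (int m)) = (-1) ^ m" "fps_const (parity_sign (- int m)) = (-1) ^ m"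
      by (simp_all add: parity_sign_def minus_one_power_iff flip: fps_const_neg)
    then show ?thesis unfolding f_def e nat_int by (simp add: distrib_left add.commute)
  qed
  moreover have "f 0 = 1" by (simp add: f_def parity_sign_def)
  ultimately show ?thesis by (simp only: sum_symmetric_interval cong: sum.cong)
qed

lemma psi_partial: "agree n psi (\<Sum>s<2 * n. fps_X ^ (s * (s + 1) div 2))"
proof -
  have "agree n psi (\<Sum>v\<in>int ` {..<2 * n}. fps_const (heaviside v) * fps_X ^ nat (v * (v + 1) div 2))"
    unfolding psi_def
  proof (rule agree_ser)
    fix v assume "heaviside v \<noteq> 0" "v * (v + 1) div 2 < int n"
    then have "0 \<le> v" "v < int n" using le_triangular[of v] by (auto simp: heaviside_def split: if_splits)
    then have "v = int (nat v)" "nat v < 2 * n" by auto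
    then show "v \<in> int ` {..<2 * n}" by blast
  qed auto
  also have "(\<Sum>v\<in>int ` {..<2 * n}. fps_const (heaviside v) * fps_X ^ nat (v * (v + 1) div 2))
      = (\<Sum>s<2 * n. fps_X ^ (s * (s + 1) div 2))"
  proof -
    have "int s * (int s + 1) div 2 = int (s * (s + 1) div 2)" for s
      by (simp only: zdiv_int of_nat_mult of_nat_add of_nat_1 of_nat_numeral)
    then show ?thesis by (simp add: sum.reindex heaviside_def)
  qed
  finally show ?thesis .
qed

text \<open>Every factor from index n on is 1 modulo q^n, so the partial products are eventually
  constant modulo q^n and the limit inherits their value.\<close>

lemma prodinf_partial:
  assumes "n \<le> N"
  shows "agree n (\<Prod>k. 1 + fps_X ^ Suc k) (\<Prod>k<N. 1 + fps_X ^ Suc k)"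
proof -
  let ?f = "\<lambda>k. 1 + fps_X ^ Suc k :: int fps"
  have stable: "agree n (\<Prod>k<M. ?f k) (\<Prod>k<N. ?f k)" if "n \<le> M" "n \<le> N" for M N
  proof -
    have *: "agree n (\<Prod>k<n + j. ?f k) (\<Prod>k<n. ?f k)" for j
    proof (induction j)
      case (Suc j)
      have "agree n (?f (n + j)) 1"
        using agree_add[OF agree_refl agree_X_power[of n "Suc (n + j)" 1]] by simp
      from agree_mult[OF Suc this] show ?case by simp
    qed simp
    from *[of "M - n"] *[of "N - n"] that show ?thesis
      by (auto intro: agree_trans agree_sym)
  qed
  have lim: "(\<lambda>N. \<Prod>k\<le>N. ?f k) \<longlonglongrightarrow> prodinf ?f"
  proof -
    \<comment> \<open>No factor is zero, so \<open>has_prod\<close> means convergence of the partial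
      products themselves.\<close>
    have "fps_nth (?f k) 0 = 1" for k by simp
    then have "?f k \<noteq> 0" for k by (metis fps_zero_nth zero_neq_one)
    with has_prod_one_plus_q show ?thesis by (auto simp: has_prod_def raw_has_prod_def)
  qed
  show ?thesis
    unfolding agree_def
  proof (intro allI impI)
    fix i assume "i < n"
    have "\<forall>\<^sub>F M in sequentially. fps_nth (\<Prod>k\<le>M. ?f k) i = fps_nth (prodinf ?f) i \<and> n \<le> M"
      using lim eventually_ge_at_top[of n] unfolding tendsto_fps_iff by (intro eventually_conj) blast+
    then obtain M where "fps_nth (\<Prod>k<Suc M. ?f k) i = fps_nth (prodinf ?f) i" "n \<le> Suc M"
      unfolding lessThan_Suc_atMost using eventually_happens'[OF sequentially_bot] le_SucI by blast
    with stable[OF \<open>n \<le> Suc M\<close> assms] \<open>i < n\<close>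
    show "fps_nth (prodinf ?f) i = fps_nth (\<Prod>k<N. ?f k) i" by (simp only: agree_def)
  qed
qed

lemma Phi_nonzero: "Phi \<noteq> 0"
proof -
  have "fps_nth Phi 0 = 1" using Phi_partial[of 1] by (simp add: agree_def)
  then show ?thesis by auto
qed

text \<open>In \<open>shanks_pentagonal\<close> at y = q the summand s carries q^(2sn + s(s+1)),
  which vanishes modulo q^n for s > 0.\<close>

lemma Euler_product: "agree n Phi (\<Prod>j\<in>{0<..n}. 1 - fps_X ^ (2 * j))"
proof -
  have "agree n (\<Sum>s\<in>{0..n}. (-1) ^ s * (\<Prod>j\<in>{s<..n}. 1 - fps_X ^ (2 * j)) * fps_X ^ (2 * s * n + s * (s + 1)))
          (\<Sum>s\<in>{0..n}. if s = 0 then (\<Prod>j\<in>{0<..n}. 1 - fps_X ^ (2 * j)) else 0)"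
  proof (rule agree_sum)
    fix s assume "s \<in> {0..n}"
    have "n \<le> 2 * s * n + s * (s + 1)" if "0 < s" using that by (cases s) auto
    then show "agree n ((-1) ^ s * (\<Prod>j\<in>{s<..n}. 1 - fps_X ^ (2 * j)) * fps_X ^ (2 * s * n + s * (s + 1)))
        (if s = 0 then (\<Prod>j\<in>{0<..n}. 1 - fps_X ^ (2 * j)) else 0)"
      by (auto intro!: agree_X_power simp del: mult_Suc_right)
  qed
  then show ?thesis
    by (intro agree_trans[OF Phi_partial])
       (simp only: shanks_pentagonal[symmetric] atMost_atLeast0 sum.delta finite_atLeastAtMost; simp)
qed

lemma Gauss_product: "agree n ((\<Prod>j<n. 1 - fps_X ^ (2 * j + 1)) * psi) (\<Prod>j\<in>{0<..n}. 1 - fps_X ^ (2 * j))"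
proof (cases "n = 0")
  \<comment> \<open>For n = 0 the sum over s < n is empty and lacks the surviving summand s =
    0.\<close>
  case False
  have "agree n (\<Sum>s<n. (\<Prod>j\<in>{s<..n}. 1 - fps_X ^ (2 * j)) * (\<Prod>j<s. 1 - fps_X ^ (2 * j + 1)) * fps_X ^ (s * (2 * n + 1)))
          (\<Sum>s<n. if s = 0 then (\<Prod>j\<in>{0<..n}. 1 - fps_X ^ (2 * j)) else 0)"
  proof (rule agree_sum)
    fix s assume "s \<in> {..<n}"
    have "n \<le> s * (2 * n + 1)" if "0 < s" using that by (cases s) auto
    then show "agree n ((\<Prod>j\<in>{s<..n}. 1 - fps_X ^ (2 * j)) * (\<Prod>j<s. 1 - fps_X ^ (2 * j + 1)) * fps_X ^ (s * (2 * n + 1)))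
        (if s = 0 then (\<Prod>j\<in>{0<..n}. 1 - fps_X ^ (2 * j)) else 0)"
      by (auto intro!: agree_X_power simp del: mult_Suc_right)
  qed
  then have "agree n ((\<Prod>j<n. 1 - fps_X ^ (2 * j + 1)) * (\<Sum>s<2 * n. fps_X ^ (s * (s + 1) div 2)))
       (\<Prod>j\<in>{0<..n}. 1 - fps_X ^ (2 * j))"
    using False by (simp only: shanks_triangular) simp
  then show ?thesis
    by (rule agree_trans[OF agree_mult[OF agree_refl psi_partial]])
qed (simp add: agree_def)

lemma prod_one_minus_power_double:
  fixes y :: "'a :: comm_ring_1"
  shows "(\<Prod>j\<in>{0<..2 * n}. 1 - y ^ j) = (\<Prod>j\<in>{0<..n}. 1 - y ^ (2 * j)) * (\<Prod>j<n. 1 - y ^ (2 * j + 1))"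
proof (induction n)
  case (Suc n)
  have "2 * Suc n = Suc (Suc (2 * n))" by simp
  then have "(\<Prod>j\<in>{0<..2 * Suc n}. 1 - y ^ j)
      = (\<Prod>j\<in>{0<..2 * n}. 1 - y ^ j) * (1 - y ^ Suc (2 * n)) * (1 - y ^ Suc (Suc (2 * n)))"
    by (simp only: prod_greaterThanAtMost_Suc le0)
  also have "\<dots> = (\<Prod>j\<in>{0<..Suc n}. 1 - y ^ (2 * j)) * (\<Prod>j<Suc n. 1 - y ^ (2 * j + 1))"
    unfolding Suc.IH by (simp add: prod_greaterThanAtMost_Suc mult_ac)
  finally show ?case .
qed simp

lemma prod_one_minus_times_one_plus:
  fixes y :: "'a :: comm_ring_1"
  shows "(\<Prod>j\<in>{0<..n}. 1 - y ^ j) * (\<Prod>k<n. 1 + y ^ Suc k) = (\<Prod>j\<in>{0<..n}. 1 - y ^ (2 * j))"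
proof (induction n)
  case (Suc n)
  have *: "(1 - y ^ Suc n) * (1 + y ^ Suc n) = 1 - y ^ (2 * Suc n)"
    unfolding mult_2 power_add by (simp add: algebra_simps)
  have "a * b * (c * d) = a * c * (b * d)" for a b c d :: 'a by (simp add: mult_ac)
  then have "(\<Prod>j\<in>{0<..Suc n}. 1 - y ^ j) * (\<Prod>k<Suc n. 1 + y ^ Suc k)
     = (\<Prod>j\<in>{0<..n}. 1 - y ^ j) * (\<Prod>k<n. 1 + y ^ Suc k) * ((1 - y ^ Suc n) * (1 + y ^ Suc n))"
    by (simp only: prod_greaterThanAtMost_Suc prod.lessThan_Suc le0)
  then show ?case
    by (simp only: Suc.IH * prod_greaterThanAtMost_Suc le0)
qed simp

text \<open>Both sides are multiplied by \<open>Phi\<close> and compared modulo q^n. There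
  \<open>Phi\<close> is the product of the 1 - q^(2j) with j \<le> 2n, which factors as
  \<open>E' n * O' * Q\<close>, and \<open>O' * psi\<close> is again \<open>Phi\<close> by
  \<open>Gauss_product\<close>. Thus no series has to be inverted, and \<open>Phi\<close> cancels at
  the end.\<close>

lemma psi_eq: "psi = (\<Prod>n. 1 + fps_X ^ Suc n) * Phi"
proof -
  let ?P = "\<Prod>n. 1 + fps_X ^ Suc n :: int fps"
  have "Phi * psi = Phi * (?P * Phi)"
  proof (rule fps_eq_if_agree)
    fix n
    define E' O' Q where "E' m = (\<Prod>j\<in>{0<..m}. 1 - fps_X ^ (2 * j) :: int fps)"
      and "O' = (\<Prod>j<n. 1 - fps_X ^ (2 * j + 1) :: int fps)"
      and "Q = (\<Prod>k<2 * n. 1 + fps_X ^ Suc k :: int fps)" for m :: nat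
    have eq: "E' (2 * n) = E' n * O' * Q"
      unfolding E'_def O'_def Q_def
      by (simp only: prod_one_minus_times_one_plus flip: prod_one_minus_power_double)
    have "agree n Phi (E' (2 * n))"
      using Euler_product[of "2 * n"] by (simp add: agree_def E'_def)
    then have "agree n (Phi * psi) (E' (2 * n) * psi)"
      by (rule agree_mult) simp
    also have "E' (2 * n) * psi = E' n * (Q * (O' * psi))"
      unfolding eq by (simp only: mult_ac)
    also have "agree n \<dots> (E' n * (Q * E' n))"
      unfolding O'_def E'_def by (intro agree_mult agree_refl Gauss_product)
    also have "agree n \<dots> (Phi * (?P * Phi))"
      unfolding E'_def Q_def
      by (intro agree_mult agree_sym[OF Euler_product] agree_sym[OF prodinf_partial]) simp
    finally show "agree n (Phi * psi) (Phi * (?P * Phi))" .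
  qed
  then show ?thesis using Phi_nonzero by simp
qed

section \<open>The lattice of signature (2, 1)\<close>

lemma two_triangular: "2 * (t * (t + 1) div 2) = t * t + (t :: int)"
proof -
  have "even (t * (t + 1))" by simp
  then show ?thesis by (simp add: algebra_simps)
qed

lemma parity_sign_eqI: "even (s - t) \<Longrightarrow> parity_sign s = parity_sign t" by (auto simp: parity_sign_def)

lemma heaviside_compl: "s + t = - 1 \<Longrightarrow> heaviside s = 1 - heaviside t" by (auto simp: heaviside_def)

lemma sq_le_sum_sq:
  fixes s t u :: int
  assumes "\<bar>u\<bar> \<le> \<bar>s - t\<bar>"
  shows "u\<^sup>2 \<le> 2 * (s\<^sup>2 + t\<^sup>2)"
proof -
  have "u\<^sup>2 \<le> (s - t)\<^sup>2" using assms by (simp only: abs_le_square_iff)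
  also have "\<dots> + (s + t)\<^sup>2 = 2 * (s\<^sup>2 + t\<^sup>2)" by (simp add: power2_eq_square algebra_simps)
  then have "(s - t)\<^sup>2 \<le> 2 * (s\<^sup>2 + t\<^sup>2)" using zero_le_power2[of "s + t"] by linarith
  finally show ?thesis .
qed

locale hecke_lattice =
  fixes a :: int
  assumes a: "a = 0 \<or> a = 1"
begin

fun E :: "int \<times> int \<times> int \<Rightarrow> int" where
  "E (x, z, k) = x * (x + 1) div 2 + z * (z + 1) div 2 - 5 * k * k - (2 * a + 1) * k - a"

fun w :: "int \<times> int \<times> int \<Rightarrow> int" where "w (x, z, k) = x - 4 * k - a"

fun p :: "int \<times> int \<times> int \<Rightarrow> int" where "p (x, z, k) = x - z - 5 * k - a"

fun wt :: "int \<times> int \<times> int \<Rightarrow> int" where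
  "wt (x, z, k) = (if even (x - z) then parity_sign (x + k + a) else 0)"

fun \<tau> :: "int \<times> int \<times> int \<Rightarrow> int \<times> int \<times> int" where
  "\<tau> (x, z, k) = (- 1 - z, - 1 - x, k)"

text \<open>The half-turn about the line through the critical point x = z = -1/2, k = -(1 + 2a)/10
  of \<open>E\<close> in the direction (5, -5, 2). This line lies in the plane p = 1/2.\<close>

fun \<kappa> :: "int \<times> int \<times> int \<Rightarrow> int \<times> int \<times> int" where
  "\<kappa> (x, z, k) = (4 * x - 5 * z - 20 * k - 3 - 4 * a, - 5 * x + 4 * z + 20 * k + 1 + 4 * a,
                  2 * x - 2 * z - 9 * k - 1 - 2 * a)"

text \<open>For fixed w and z, \<open>E\<close> is a quadratic polynomial in k, and k' is the other
  argument with the same value. The division by 3 is exact precisely when w \<equiv> a + 2 (mod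
  3).\<close>

fun \<rho> :: "int \<times> int \<times> int \<Rightarrow> int \<times> int \<times> int" where
  "\<rho> (x, z, k) = (let k' = - k - (4 * w (x, z, k) + 1 + 2 * a) div 3 in (x + 4 * (k' - k), z, k'))"

lemma two_E: "2 * E (x, z, k) = x * x + x + z * z + z - 10 * k * k - 2 * (2 * a + 1) * k - 2 * a"
  using two_triangular[of x] two_triangular[of z] by (simp add: algebra_simps)

lemma E_eqI: "2 * E u = 2 * E v \<Longrightarrow> E u = E v" by simp

lemma E_\<tau>: "E (\<tau> v) = E v"
  by (cases v, rule E_eqI) (simp only: \<tau>.simps two_E, simp add: algebra_simps)

lemma E_\<kappa>: "E (\<kappa> v) = E v"
  by (cases v, rule E_eqI) (simp only: \<kappa>.simps two_E, simp add: algebra_simps)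

lemma \<kappa>_\<kappa>: "\<kappa> (\<kappa> v) = v"
  by (cases v) simp

lemma wt_\<kappa>: "wt (\<kappa> v) = wt v"
  by (cases v) (auto simp: parity_sign_def)

lemma wt_\<tau>: "wt (\<tau> v) = - wt v"
  by (cases v) (auto simp: parity_sign_def)

lemma p_\<kappa>: "p (\<kappa> v) = 1 - p v"
  by (cases v) simp

lemma w_\<kappa>: "w (\<kappa> (x, z, k)) = 3 * z - 4 * w (x, z, k) + 1 - a"
  by simp

text \<open>The quotient \<open>j\<close> is exact on this class, and odd because 4w + 1 + 2a is. So
  k changes parity while x does not, which reverses the weight. The value of w after \<kappa>
  depends on z and w alone (\<open>w_\<kappa>\<close>), and \<rho> keeps both.\<close>

lemma \<rho>_props:
  assumes "w v mod 3 = (a + 2) mod 3"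
  shows "E (\<rho> v) = E v" "wt (\<rho> v) = - wt v" "\<rho> (\<rho> v) = v" "w (\<rho> v) = w v" "w (\<kappa> (\<rho> v)) = w (\<kappa> v)"
proof -
  obtain x z k where v: "v = (x, z, k)" by (cases v) auto
  have "3 dvd 4 * W + 1 + 2 * a" if "W mod 3 = (a + 2) mod 3" for W
    using that a by presburger
  from this[OF assms] obtain j where j: "4 * w v + 1 + 2 * a = 3 * j" by blast
  have "odd (3 * j)" unfolding j[symmetric] by simp
  then have jodd: "odd j" by simp
  have \<rho>: "\<rho> (x, z, k) = (x - 8 * k - 4 * j, z, - k - j)"
    using j by (simp add: v Let_def del: w.simps)
  show w: "w (\<rho> v) = w v" by (simp add: v \<rho> del: \<rho>.simps)
  then show "w (\<kappa> (\<rho> v)) = w (\<kappa> v)" by (simp only: v \<rho> w_\<kappa>)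
  have x: "4 * x = 3 * j + 16 * k + 2 * a - 1" using j by (simp add: v)
  have "2 * E (\<rho> v) = 2 * E v"
    unfolding v \<rho> two_E using x by algebra
  then show "E (\<rho> v) = E v" by simp
  show "wt (\<rho> v) = - wt v"
    using jodd by (auto simp: v \<rho> parity_sign_def simp del: \<rho>.simps)
  have "\<rho> (x - 8 * k - 4 * j, z, - k - j) = (x, z, k)"
    using j by (simp add: v Let_def)
  then show "\<rho> (\<rho> v) = v" by (simp only: v \<rho>)
qed

text \<open>
  The squares come from completing \<open>E\<close>:
  \<open>40 E = 5(2x+1)\<^sup>2 + 5(2z+1)\<^sup>2 - 2(10k+1+2a)\<^sup>2 + const\<close>.
\<close>

lemma admissible_if_bounded:
  assumes "\<And>x z k. c (x, z, k) \<noteq> 0 \<Longrightarrow>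
             (10 * k + 1 + 2 * a)\<^sup>2 \<le> 2 * ((2 * x + 1)\<^sup>2 + (2 * z + 1)\<^sup>2)"
  shows "admissible c E"
proof -
  \<comment> \<open>With X the sum of the two squares and K the negative one, the hypothesis K \<le>
    2X gives 5X - 2K \<ge> X. The remaining constant is -8 for a = 0 and -32 for a = 1.\<close>
  have bound: "(2 * x + 1)\<^sup>2 + (2 * z + 1)\<^sup>2 \<le> 40 * E (x, z, k) + 32" if "c (x, z, k) \<noteq> 0" for x z k
  proof -
    have "40 * E (x, z, k) = 5 * ((2 * x + 1)\<^sup>2 + (2 * z + 1)\<^sup>2) - 2 * (10 * k + 1 + 2 * a)\<^sup>2
            + 2 * (1 + 2 * a)\<^sup>2 - 40 * a - 10"
    proof -
      have "40 * E (x, z, k) = 20 * (2 * E (x, z, k))" by (simp del: E.simps)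
      then show ?thesis unfolding two_E
        by (simp only: power2_eq_square) (simp add: algebra_simps del: E.simps)
    qed
    moreover have "2 * (1 + 2 * a)\<^sup>2 - 40 * a - 10 \<ge> - 32" using a by auto
    moreover have "X \<le> T + 32" if "T = 5 * X - 2 * K + A - 40 * a - 10" "- 32 \<le> A - 40 * a - 10" "K \<le> 2 * X"
      for T X K A
      using that by presburger
    ultimately show ?thesis using assms[OF that] by blast
  qed
  have abs_le: "\<bar>t\<bar> \<le> N" if "t\<^sup>2 \<le> N" for t N :: int
  proof -
    have "\<bar>t\<bar> * 1 \<le> \<bar>t\<bar> * \<bar>t\<bar>" if "t \<noteq> 0" using that by (intro mult_left_mono) auto
    with that show ?thesis by (cases "t = 0") (auto simp: power2_eq_square)
  qed
  have "finite {v. c v \<noteq> 0 \<and> E v = int n}" for n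
  proof (rule finite_subset)
    define N where "N = 40 * int n + 32"
    show "{v. c v \<noteq> 0 \<and> E v = int n} \<subseteq> {- N - 1..N} \<times> {- N - 1..N} \<times> {- 2 * N - 3..2 * N}"
    proof
      fix v assume v: "v \<in> {v. c v \<noteq> 0 \<and> E v = int n}"
      obtain x z k where xzk: "v = (x, z, k)" by (cases v) auto
      with v have c: "c (x, z, k) \<noteq> 0" and "E (x, z, k) = int n" by auto
      then have N: "(2 * x + 1)\<^sup>2 + (2 * z + 1)\<^sup>2 \<le> N" using bound[OF c] by (simp add: N_def)
      then have "(2 * x + 1)\<^sup>2 \<le> N" "(2 * z + 1)\<^sup>2 \<le> N"
        using zero_le_power2[of "2 * x + 1"] zero_le_power2[of "2 * z + 1"] by linarith+
      moreover have "(10 * k + 1 + 2 * a)\<^sup>2 \<le> 2 * N"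
        by (rule order_trans[OF assms[OF c]]) (use N in simp)
      ultimately have "\<bar>2 * x + 1\<bar> \<le> N" "\<bar>2 * z + 1\<bar> \<le> N" "\<bar>10 * k + 1 + 2 * a\<bar> \<le> 2 * N"
        by (auto intro: abs_le)
      then show "v \<in> {- N - 1..N} \<times> {- N - 1..N} \<times> {- 2 * N - 3..2 * N}"
        using a by (auto simp: xzk)
    qed
  qed simp
  moreover have "0 \<le> E v" if "c v \<noteq> 0" for v
  proof -
    obtain x z k where v: "v = (x, z, k)" by (cases v) auto
    \<comment> \<open>The sum of the squares is positive, so 40 E > -32, and the integer E is at
      least 0.\<close>
    have "2 * x + 1 \<noteq> 0" by presburger
    then have "0 < (2 * x + 1)\<^sup>2" by (simp only: zero_less_power2 not_False_eq_True)
    moreover have "0 \<le> (2 * z + 1)\<^sup>2" by simp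
    moreover have "(2 * x + 1)\<^sup>2 + (2 * z + 1)\<^sup>2 \<le> 40 * E v + 32"
      using bound that by (simp only: v)
    moreover have "0 \<le> t" if "0 < r" "0 \<le> s" "r + s \<le> 40 * t + 32" for r s t :: int
      using that by linarith
    ultimately show ?thesis by blast
  qed
  ultimately show ?thesis by (simp add: admissible_def)
qed

text \<open>
  \<open>heaviside s - heaviside t\<close> cuts out the cone between the walls \<open>s = 0\<close> and \<open>t = 0\<close>, with opposite signs on its two
  halves. \<open>C\<close> belongs to the right-hand side of the theorem, one residue class of \<open>B\<close> to the left-hand side.
\<close>

definition A :: "int \<times> int \<times> int \<Rightarrow> int" where "A v = (heaviside (w v) - heaviside (p v - 1)) * wt v"

definition B :: "int \<times> int \<times> int \<Rightarrow> int" where "B v = (heaviside (w v) + heaviside (w (\<kappa> v)) - 1) * wt v"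

definition C :: "int \<times> int \<times> int \<Rightarrow> int" where "C v = (heaviside (w v) - heaviside (- 1 - snd (snd v))) * wt v"

definition D :: "int \<times> int \<times> int \<Rightarrow> int" where "D v = (heaviside (p v - 1) - heaviside (- 1 - snd (snd v))) * wt v"

lemma admissible_A: "admissible A E"
proof (rule admissible_if_bounded)
  fix x z k assume "A (x, z, k) \<noteq> 0"
  then have "(w (x, z, k) \<ge> 0 \<and> p (x, z, k) \<le> 0) \<or> (w (x, z, k) < 0 \<and> p (x, z, k) \<ge> 1)"
    by (auto simp: A_def heaviside_def split: if_splits)
  \<comment> \<open>On either half of the cone, one sign of k is controlled by the wall of w and the
    other by the wall of p.\<close>
  then have "\<bar>10 * k + 1 + 2 * a\<bar> \<le> \<bar>(2 * x + 1) - (2 * z + 1)\<bar>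
      \<or> \<bar>4 * (10 * k + 1 + 2 * a)\<bar> \<le> \<bar>5 * (2 * x + 1)\<bar>"
    using a by auto
  then show "(10 * k + 1 + 2 * a)\<^sup>2 \<le> 2 * ((2 * x + 1)\<^sup>2 + (2 * z + 1)\<^sup>2)"
  proof
    assume "\<bar>4 * (10 * k + 1 + 2 * a)\<bar> \<le> \<bar>5 * (2 * x + 1)\<bar>"
    then have "(4 * (10 * k + 1 + 2 * a))\<^sup>2 \<le> (5 * (2 * x + 1))\<^sup>2" by (simp only: abs_le_square_iff)
    then have "16 * (10 * k + 1 + 2 * a)\<^sup>2 \<le> 25 * (2 * x + 1)\<^sup>2"
      unfolding power_mult_distrib by simp
    also have "\<dots> \<le> 16 * (2 * ((2 * x + 1)\<^sup>2 + (2 * z + 1)\<^sup>2))"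
    proof -
      have "25 * s \<le> 16 * (2 * (s + t))" if "0 \<le> s" "0 \<le> t" for s t :: int
        using that mult_right_mono[of 25 32 s] by simp
      then show ?thesis by simp
    qed
    finally show ?thesis by simp
  qed (rule sq_le_sum_sq)
qed

lemma admissible_D: "admissible D E"
proof (rule admissible_if_bounded)
  fix x z k assume "D (x, z, k) \<noteq> 0"
  then have "(k \<ge> 0 \<and> p (x, z, k) \<ge> 1) \<or> (k < 0 \<and> p (x, z, k) \<le> 0)"
    by (auto simp: D_def heaviside_def split: if_splits)
  then have "\<bar>10 * k + 1 + 2 * a\<bar> \<le> \<bar>(2 * x + 1) - (2 * z + 1)\<bar>"
    using a by auto
  then show "(10 * k + 1 + 2 * a)\<^sup>2 \<le> 2 * ((2 * x + 1)\<^sup>2 + (2 * z + 1)\<^sup>2)"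
    by (rule sq_le_sum_sq)
qed

text \<open>\<tau> keeps k and p, hence both walls of \<open>D\<close>. It replaces x by -1 - z,
  which has the other parity when x \<equiv> z (mod 2), so the weight changes sign.\<close>

lemma ser_D: "ser D E = 0"
proof (rule ser_antisymmetric)
  fix v
  show "\<tau> (\<tau> v) = v \<and> E (\<tau> v) = E v \<and> D (\<tau> v) = - D v"
    unfolding D_def E_\<tau> wt_\<tau> by (cases v) (simp del: wt.simps E.simps add: algebra_simps)
qed

text \<open>Inserting the wall p = 1/2 splits \<open>C\<close> into \<open>A\<close> and the
  vanishing \<open>D\<close>.\<close>

lemma ser_C: "ser C E = ser A E"
proof -
  have "C = (\<lambda>v. A v + D v)" by (auto simp: C_def A_def D_def algebra_simps)
  then show ?thesis by (simp add: ser_add admissible_A admissible_D ser_D)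
qed

text \<open>\<kappa> exchanges the two sides of the wall p = 1/2, so its two contributions add up to
  the constant -1 in \<open>B\<close>.\<close>

lemma B_eq: "B v = A v + A (\<kappa> v)"
proof -
  have *: "heaviside (p (\<kappa> v) - 1) = 1 - heaviside (p v - 1)"
    unfolding p_\<kappa> by (rule heaviside_compl) simp
  show ?thesis unfolding A_def B_def wt_\<kappa> * by (simp add: algebra_simps)
qed

lemma B_\<kappa>: "B (\<kappa> v) = B v"
  by (simp add: B_eq \<kappa>_\<kappa>)

lemma admissible_A_\<kappa>: "admissible (\<lambda>v. A (\<kappa> v)) E"
  using admissible_A by (rule admissible_involution) (simp_all add: \<kappa>_\<kappa> E_\<kappa>)

lemma admissible_B: "admissible B E"
proof -
  have "finite {v. B v \<noteq> 0 \<and> E v = int n}" for n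
    by (rule finite_subset[of _ "{v. A v \<noteq> 0 \<and> E v = int n} \<union> {v. A (\<kappa> v) \<noteq> 0 \<and> E v = int n}"])
       (use admissible_A admissible_A_\<kappa> in
         \<open>auto simp: admissible_def B_eq simp del: E.simps \<kappa>.simps split_paired_All\<close>)
  moreover have "0 \<le> E v" if "B v \<noteq> 0" for v
  proof -
    have "A v \<noteq> 0 \<or> A (\<kappa> v) \<noteq> 0" using that unfolding B_eq by auto
    then show ?thesis using admissible_A admissible_A_\<kappa> unfolding admissible_def by blast
  qed
  ultimately show ?thesis by (simp add: admissible_def)
qed

section \<open>Residue classes of w modulo 3\<close>

definition B_class :: "int \<Rightarrow> int \<times> int \<times> int \<Rightarrow> int" where
  "B_class i v = (if w v mod 3 = i mod 3 then B v else 0)"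

lemma admissible_B_class: "admissible (B_class i) E"
  by (rule admissible_mono[OF admissible_B]) (auto simp: B_class_def split: if_splits)

text \<open>This is the class on which \<rho> preserves \<open>E\<close>. Both walls of
  \<open>B\<close> are unchanged there and the weight is reversed.\<close>

lemma ser_B_class_vanishing: "ser (B_class (a + 2)) E = 0"
proof (rule ser_antisymmetric)
  fix v assume "B_class (a + 2) v \<noteq> 0"
  then have "w v mod 3 = (a + 2) mod 3" by (auto simp: B_class_def split: if_splits)
  from \<rho>_props[OF this] show "\<rho> (\<rho> v) = v \<and> E (\<rho> v) = E v \<and> B_class (a + 2) (\<rho> v) = - B_class (a + 2) v"
    by (simp add: B_class_def B_def)
qed

text \<open>By \<open>w_\<kappa>\<close>, \<kappa> sends w to 1 - a - w modulo 3 and so exchanges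
  the classes 1 and -a \<equiv> 2a.\<close>

lemma ser_B_class_swap: "ser (B_class 1) E = ser (B_class (2 * a)) E"
proof -
  have "B_class 1 (\<kappa> v) = B_class (2 * a) v" for v
  proof -
    have "w (\<kappa> v) mod 3 = 1 mod 3 \<longleftrightarrow> w v mod 3 = 2 * a mod 3"
    proof -
      obtain x z k where v: "v = (x, z, k)" by (cases v) auto
      have "(3 * z - 4 * W + 1 - a) mod 3 = 1 mod 3 \<longleftrightarrow> W mod 3 = 2 * a mod 3" for W
      proof -
        have "3 dvd 3 * t - s \<longleftrightarrow> 3 dvd s" for s t :: int by presburger
        from this[of "z - W - a" "W - 2 * a"] show ?thesis
          unfolding mod_eq_dvd_iff by (simp add: algebra_simps)
      qed
      then show ?thesis by (simp only: v w_\<kappa>)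
    qed
    then show ?thesis by (simp add: B_class_def B_\<kappa>)
  qed
  then have "ser (B_class (2 * a)) E = ser (\<lambda>v. B_class 1 (\<kappa> v)) E" by (simp only:)
  also have "\<dots> = ser (B_class 1) E"
    by (rule ser_involution) (simp_all only: \<kappa>_\<kappa> E_\<kappa>)
  finally show ?thesis by simp
qed

text \<open>The series of \<open>B\<close> is twice that of \<open>A\<close> by \<open>B_eq\<close>.
  It is also twice that of the class 2a, because a + 2, 1 and 2a represent all residues modulo 3,
  the first class vanishes and the other two agree.\<close>

lemma ser_A: "ser A E = ser (B_class (2 * a)) E"
proof -
  have "B = (\<lambda>v. (B_class (a + 2) v + B_class 1 v) + B_class (2 * a) v)"
  proof
    fix v
    have "W mod 3 = 0 \<or> W mod 3 = 1 \<or> W mod 3 = 2" for W :: int by presburger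
    from this[of "w v"] show "B v = (B_class (a + 2) v + B_class 1 v) + B_class (2 * a) v"
      using a by (auto simp: B_class_def)
  qed
  moreover have "admissible (\<lambda>v. B_class (a + 2) v + B_class 1 v) E"
    by (rule admissible_mono[OF admissible_B]) (auto simp: B_class_def split: if_splits)
  ultimately have "ser B E = 2 * ser (B_class (2 * a)) E"
    by (simp add: ser_add admissible_B_class ser_B_class_vanishing ser_B_class_swap)
  moreover have "ser B E = ser A E + ser (\<lambda>v. A (\<kappa> v)) E"
    unfolding B_eq by (rule ser_add[OF admissible_A admissible_A_\<kappa>])
  moreover have "ser (\<lambda>v. A (\<kappa> v)) E = ser A E"
    by (rule ser_involution) (simp_all only: \<kappa>_\<kappa> E_\<kappa>)
  ultimately have "2 * ser A E = 2 * ser (B_class (2 * a)) E" by simp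
  then show ?thesis by simp
qed

end

section \<open>Both sides as lattice sums\<close>

lemma half_even:
  fixes x :: real
  assumes "x = of_int d / 2" "even d" "of_int b / 2 \<le> x"
  shows "x = of_int (d div 2) \<and> b \<le> 2 * (d div 2)"
  using assms by (auto elim!: evenE)

lemma mem_same_parity: "(k, m) \<in> same_parity \<longleftrightarrow> even (k - m)"
  by (simp add: same_parity_def mod_eq_dvd_iff)

context hecke_lattice
begin

text \<open>The vacuous membership test matches the shape in \<open>indef_sum_eq_ser\<close>.\<close>

definition R_coeff :: "int \<times> int \<Rightarrow> int" where
  "R_coeff = (\<lambda>(k, m). if (k, m) \<in> UNIV then (heaviside k + heaviside m - 1) * parity_sign (k + m) else 0)"

definition R_exp :: "int \<times> int \<Rightarrow> int" where
  "R_exp = (\<lambda>(k, m). (6 * (k * k) + m * m + 8 * (k * m) + (4 * a + 2) * k + (2 * a + 1) * m) div 2)"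

definition L_coeff :: "int \<times> int \<Rightarrow> int" where
  "L_coeff = (\<lambda>(k, m). if (k, m) \<in> same_parity then (heaviside k + heaviside m - 1) * parity_sign m else 0)"

definition L_exp :: "int \<times> int \<Rightarrow> int" where
  "L_exp = (\<lambda>(k, m). (k * k + m * m + 8 * (k * m) + (2 * a + 1) * k + (2 * a + 3) * m) div 2)"

lemma two_R_exp: "2 * R_exp (k, m) = 6 * (k * k) + m * m + 8 * (k * m) + (4 * a + 2) * k + (2 * a + 1) * m"
proof -
  have "even (6 * (k * k) + m * m + 8 * (k * m) + (4 * a + 2) * k + (2 * a + 1) * m)" by simp
  then show ?thesis by (simp add: R_exp_def)
qed

lemma two_L_exp:
  assumes "even (k - m)"
  shows "2 * L_exp (k, m) = k * k + m * m + 8 * (k * m) + (2 * a + 1) * k + (2 * a + 3) * m"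
proof -
  have "even (k * k + m * m + 8 * (k * m) + (2 * a + 1) * k + (2 * a + 3) * m)" by auto
  then show ?thesis by (simp add: L_exp_def)
qed

lemma ser_R_psi:
  assumes "admissible R_coeff R_exp"
  shows "ser R_coeff R_exp * psi = ser C E"
proof -
  \<comment> \<open>The value of x makes w equal to m. The numbers n and -1 - n have the same
    triangular number and opposite parities, so exactly one of them is congruent to x and serves as
    z.\<close>
  define h :: "(int \<times> int) \<times> int \<Rightarrow> int \<times> int \<times> int"
    where "h = (\<lambda>((k, m), n). let x = m + 4 * k + a in (x, if even (x - n) then n else - 1 - n, k))"
  define g :: "int \<times> int \<times> int \<Rightarrow> (int \<times> int) \<times> int"
    where "g = (\<lambda>(x, z, k). ((k, x - 4 * k - a), if 0 \<le> z then z else - 1 - z))"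
  have supp: "0 \<le> n" if "(case u of (u, v) \<Rightarrow> R_coeff u * heaviside v) \<noteq> 0" "u = ((k, m), n)" for u k m n
    using that by (auto simp: heaviside_def split: if_splits)
  have "ser C E = ser (\<lambda>(u, v). R_coeff u * heaviside v) (\<lambda>(u, v). R_exp u + v * (v + 1) div 2)"
  proof (rule ser_reindex[where h = h])
    show "inj_on h {u. (case u of (u, v) \<Rightarrow> R_coeff u * heaviside v) \<noteq> 0}"
    proof (rule inj_on_inverseI)
      fix u assume "u \<in> {u. (case u of (u, v) \<Rightarrow> R_coeff u * heaviside v) \<noteq> 0}"
      moreover obtain k m n where u: "u = ((k, m), n)" by (metis prod.exhaust)
      ultimately have "0 \<le> n" using supp by blast
      then show "g (h u) = u" by (auto simp: u g_def h_def Let_def)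
    qed
  next
    fix v assume C: "C v \<noteq> 0"
    obtain x z k where v: "v = (x, z, k)" by (cases v) auto
    have even: "even (x - z)" using C by (auto simp: v C_def split: if_splits)
    then have "h (g v) = v" by (auto simp: v h_def g_def Let_def)
    moreover have "(case g v of (u, v) \<Rightarrow> R_coeff u * heaviside v) \<noteq> 0"
      using C by (auto simp: v C_def g_def R_coeff_def heaviside_def parity_sign_def split: if_splits)
    ultimately show "\<exists>u. (case u of (u, v) \<Rightarrow> R_coeff u * heaviside v) \<noteq> 0 \<and> h u = v" by blast
  next
    fix u assume u: "(case u of (u, v) \<Rightarrow> R_coeff u * heaviside v) \<noteq> 0"
    obtain k m n where ukmn: "u = ((k, m), n)" by (metis prod.exhaust)
    obtain z where h: "h u = (m + 4 * k + a, z, k)" "even (m + 4 * k + a - z)" "z * z + z = n * n + n"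
      by (rule that[of "if even (m + 4 * k + a - n) then n else - 1 - n"])
         (auto simp: ukmn h_def Let_def algebra_simps)
    have "parity_sign (m + 4 * k + a + k + a) = parity_sign (k + m)" by (rule parity_sign_eqI) simp
    then have "C (h u) = (heaviside m - heaviside (- 1 - k)) * parity_sign (k + m)"
      using h(2) by (simp add: h(1) C_def)
    also have "heaviside (- 1 - k) = 1 - heaviside k" by (rule heaviside_compl) simp
    also have "heaviside n = 1" using supp[OF u ukmn] by (simp add: heaviside_def)
    then have "(heaviside m - (1 - heaviside k)) * parity_sign (k + m) = (case u of (u, v) \<Rightarrow> R_coeff u * heaviside v)"
      by (simp add: ukmn R_coeff_def)
    finally show "C (h u) = (case u of (u, v) \<Rightarrow> R_coeff u * heaviside v)" .
    \<comment> \<open>The constant terms \<open>a * a + a - 2 * a\<close> cancel because a is 0 or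
      1.\<close>
    have "2 * E (h u) = 2 * (R_exp (k, m) + n * (n + 1) div 2)"
      unfolding h(1) two_E distrib_left two_R_exp two_triangular using h(3) a
      by (auto simp: algebra_simps)
    then show "E (h u) = (case u of (u, v) \<Rightarrow> R_exp u + v * (v + 1) div 2)"
      by (simp add: ukmn del: E.simps)
  qed
  then show ?thesis
    unfolding psi_def by (simp add: ser_mult[OF assms admissible_psi])
qed

lemma ser_L_Phi:
  assumes "admissible L_coeff L_exp"
  shows "ser L_coeff L_exp * Phi = ser (B_class (2 * a)) E"
proof -
  \<comment> \<open>For a = 1 the linear part of \<open>h\<close> changes sign. This exchanges the
    sides of both walls; the sign this gives the cone factor is cancelled by the one in the
    weight.\<close>
  define \<epsilon> where "\<epsilon> = 1 - 2 * a"
  have \<epsilon>: "\<epsilon> * (\<epsilon> * t) = t" for t using a by (auto simp: \<epsilon>_def)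
  \<comment> \<open>Here m and k parametrise the two walls of \<open>B\<close> (\<open>w_h\<close>,
    \<open>w_\<kappa>_h\<close>), and n runs along the line on which both are constant. On that line
    \<open>E\<close> becomes 3n^2 + n plus a constant after completing the square.\<close>
  define h :: "(int \<times> int) \<times> int \<Rightarrow> int \<times> int \<times> int"
    where "h = (\<lambda>((k, m), n). (\<epsilon> * (4 * n - 5 * m), \<epsilon> * (k + 4 * m) - 2 * a, \<epsilon> * (n - 2 * m)))"
  define g :: "int \<times> int \<times> int \<Rightarrow> (int \<times> int) \<times> int"
    where "g = (\<lambda>(x, z, k). let m = \<epsilon> * (w (x, z, k) + a) div 3 in
                 ((\<epsilon> * (z + 2 * a) - 4 * m, m), \<epsilon> * k + 2 * m))"
  have w_h: "w (h ((k, m), n)) = 3 * (\<epsilon> * m) - a" for k m n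
    by (simp add: h_def algebra_simps)
  have w_\<kappa>_h: "w (\<kappa> (h ((k, m), n))) = 3 * (\<epsilon> * k) + 1 - 3 * a" for k m n
    by (simp add: h_def algebra_simps)
  have g_h: "g (h ((k, m), n)) = ((k, m), n)" for k m n
  proof -
    have "\<epsilon> * (w (h ((k, m), n)) + a) div 3 = m"
      unfolding w_h by (simp add: \<epsilon> mult.left_commute[of _ 3])
    then show ?thesis
      by (simp add: g_def h_def Let_def \<epsilon> del: w.simps)
  qed
  have h_g: "h (g v) = v" if "w v mod 3 = 2 * a mod 3" for v
  proof -
    obtain x z k where v: "v = (x, z, k)" by (cases v) auto
    have "3 dvd w v + a" using that by (simp add: mod_eq_dvd_iff) presburger
    then obtain j where j: "w v + a = 3 * j" by blast
    have "\<epsilon> * (w v + a) = 3 * (\<epsilon> * j)" unfolding j by simp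
    then have "\<epsilon> * (w v + a) div 3 = \<epsilon> * j"
      by (rule ssubst) simp
    then have g: "g v = ((\<epsilon> * (z + 2 * a) - 4 * (\<epsilon> * j), \<epsilon> * j), \<epsilon> * k + 2 * (\<epsilon> * j))"
      by (simp add: g_def v Let_def del: w.simps)
    have "x = 4 * k + 3 * j" using j by (simp add: v)
    then show ?thesis
      unfolding v g[unfolded v] h_def prod.case using a by (auto simp: \<epsilon>_def)
  qed
  have coeff: "B_class (2 * a) (h u) = (case u of (u, v) \<Rightarrow> L_coeff u * parity_sign v)" for u
  proof -
    obtain k m n where u: "u = ((k, m), n)" by (metis prod.exhaust)
    have "even (\<epsilon> * (4 * n - 5 * m) - (\<epsilon> * (k + 4 * m) - 2 * a)) \<longleftrightarrow> even (k - m)"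
      using a by (auto simp: \<epsilon>_def)
    moreover have "parity_sign (\<epsilon> * (4 * n - 5 * m) + \<epsilon> * (n - 2 * m) + a) = \<epsilon> * (parity_sign m * parity_sign n)"
      using a by (auto simp: \<epsilon>_def parity_sign_def)
    ultimately have wt: "wt (h u) = (if even (k - m) then \<epsilon> * (parity_sign m * parity_sign n) else 0)"
      by (simp only: u h_def prod.case wt.simps)
    have "w (h u) mod 3 = 2 * a mod 3" unfolding u w_h mod_eq_dvd_iff by simp
    then have "B_class (2 * a) (h u) = (heaviside (w (h u)) + heaviside (w (\<kappa> (h u))) - 1) * wt (h u)"
      by (simp add: B_class_def B_def)
    also have "heaviside (w (h u)) = a + \<epsilon> * heaviside m" unfolding u w_h using a by (auto simp: heaviside_def \<epsilon>_def)
    also have "heaviside (w (\<kappa> (h u))) = a + \<epsilon> * heaviside k" unfolding u w_\<kappa>_h using a by (auto simp: heaviside_def \<epsilon>_def)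
    also have "a + \<epsilon> * heaviside m + (a + \<epsilon> * heaviside k) - 1 = \<epsilon> * (heaviside k + heaviside m - 1)"
      by (simp add: \<epsilon>_def algebra_simps)
    finally show ?thesis unfolding wt
      using \<epsilon>[of "(heaviside k + heaviside m - 1) * (parity_sign m * parity_sign n)"] by (simp add: u L_coeff_def mem_same_parity mult_ac)
  qed
  have "ser (B_class (2 * a)) E = ser (\<lambda>(u, v). L_coeff u * parity_sign v) (\<lambda>(u, v). L_exp u + (3 * v * v + v))"
  proof (rule ser_reindex[where h = h])
    show "inj_on h {u. (case u of (u, v) \<Rightarrow> L_coeff u * parity_sign v) \<noteq> 0}"
    proof (rule inj_on_inverseI)
      fix u :: "(int \<times> int) \<times> int"
      obtain k m n where "u = ((k, m), n)" by (metis prod.exhaust)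
      then show "g (h u) = u" by (simp only: g_h)
    qed
  next
    fix v assume v: "B_class (2 * a) v \<noteq> 0"
    then have "w v mod 3 = 2 * a mod 3" by (auto simp: B_class_def split: if_splits)
    then have "h (g v) = v" by (rule h_g)
    with v coeff show "\<exists>u. (case u of (u, v) \<Rightarrow> L_coeff u * parity_sign v) \<noteq> 0 \<and> h u = v" by metis
  next
    fix u assume u: "(case u of (u, v) \<Rightarrow> L_coeff u * parity_sign v) \<noteq> 0"
    obtain k m n where ukmn: "u = ((k, m), n)" by (metis prod.exhaust)
    have parity: "even (k - m)" using u by (auto simp: ukmn L_coeff_def mem_same_parity split: if_splits)
    have "2 * E (h u) = 2 * (L_exp (k, m) + (3 * n * n + n))"
      unfolding ukmn h_def prod.case two_E distrib_left[of 2] two_L_exp[OF parity]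
      using a by (auto simp: \<epsilon>_def algebra_simps)
    then show "E (h u) = (case u of (u, v) \<Rightarrow> L_exp u + (3 * v * v + v))"
      by (simp add: ukmn del: E.simps)
  qed (rule coeff)
  then show ?thesis
    unfolding Phi_def by (simp add: ser_mult[OF assms admissible_Phi])
qed

text \<open>Power series over the integers have no zero divisors, so the auxiliary factor
  \<open>Phi\<close> cancels.\<close>

lemma ser_L_eq:
  assumes "admissible L_coeff L_exp" "admissible R_coeff R_exp"
  shows "ser L_coeff L_exp = (\<Prod>n. 1 + fps_X ^ Suc n) * ser R_coeff R_exp"
proof -
  have "ser L_coeff L_exp * Phi = ser R_coeff R_exp * psi"
    by (simp add: ser_L_Phi ser_R_psi assms ser_C ser_A)
  also have "\<dots> = (\<Prod>n. 1 + fps_X ^ Suc n) * ser R_coeff R_exp * Phi"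
    by (simp add: psi_eq mult_ac)
  finally show ?thesis using Phi_nonzero by simp
qed

text \<open>Both identities at once: a = 0 gives the first and a = 1 the second. The exponents stay
  real-valued to match the form of the theorem.\<close>

lemma indef_sum_identity:
  fixes e f :: "int \<Rightarrow> int \<Rightarrow> real"
  assumes e: "\<And>k m. e k m = of_int (k * k + m * m + 8 * (k * m) + (2 * a + 1) * k + (2 * a + 3) * m) / 2"
    and e_ge: "\<And>k m. (k, m) \<in> {0..} \<times> {0..} \<union> {..<0} \<times> {..<0} \<Longrightarrow> of_int (\<bar>k\<bar> + \<bar>m\<bar>) / 2 \<le> e k m"
    and f: "\<And>k m. f k m = of_int (6 * (k * k) + m * m + 8 * (k * m) + (4 * a + 2) * k + (2 * a + 1) * m) / 2"
    and f_ge: "\<And>k m. (k, m) \<in> {0..} \<times> {0..} \<union> {..<0} \<times> {..<0} \<Longrightarrow> of_int (\<bar>k\<bar> + \<bar>m\<bar>) / 2 \<le> f k m"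
  shows "indef_sum same_parity (\<lambda>k m. (-1) ^ nat \<bar>m\<bar> * q_pow (e k m))
       = (\<Prod>n. 1 + fps_X ^ Suc n) * indef_sum UNIV (\<lambda>k m. (-1) ^ nat \<bar>k + m\<bar> * q_pow (f k m))"
proof -
  have "e k m = of_int (L_exp (k, m)) \<and> \<bar>k\<bar> + \<bar>m\<bar> \<le> 2 * L_exp (k, m)"
    if "(k, m) \<in> {0..} \<times> {0..} \<union> {..<0} \<times> {..<0}" for k m
    unfolding L_exp_def prod.case by (rule half_even[OF e _ e_ge[OF that]]) auto
  note L = indef_sum_eq_ser[where S = same_parity and s = "\<lambda>k m. m", OF this, folded L_coeff_def]
  have "f k m = of_int (R_exp (k, m)) \<and> \<bar>k\<bar> + \<bar>m\<bar> \<le> 2 * R_exp (k, m)"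
    if "(k, m) \<in> {0..} \<times> {0..} \<union> {..<0} \<times> {..<0}" for k m
    unfolding R_exp_def prod.case by (rule half_even[OF f _ f_ge[OF that]]) simp
  note R = indef_sum_eq_ser[where S = UNIV and s = "\<lambda>k m. k + m", OF this, folded R_coeff_def]
  show ?thesis
    by (simp only: L(1) R(1) ser_L_eq[OF L(2) R(2)])
qed

end

theorem corollary1p3:
  shows "(indef_sum same_parity
            (\<lambda>k m. (-1) ^ nat \<bar>m\<bar> * q_pow (k^2/2 + m^2/2 + 4*k*m + k/2 + 3*m/2))
          = (\<Prod>n. 1 + fps_X ^ Suc n) *
            indef_sum UNIV
              (\<lambda>k m. (-1) ^ nat \<bar>k + m\<bar> * q_pow (3*k^2 + m^2/2 + 4*k*m + k + m/2)))
       \<and> (indef_sum same_parity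
            (\<lambda>k m. (-1) ^ nat \<bar>m\<bar> * q_pow (k^2/2 + m^2/2 + 4*k*m + 3*k/2 + 5*m/2))
          = (\<Prod>n. 1 + fps_X ^ Suc n) *
            indef_sum UNIV
              (\<lambda>k m. (-1) ^ nat \<bar>k + m\<bar> * q_pow (3*k^2 + m^2/2 + 4*k*m + 3*k + 3*m/2)))"
proof
  interpret hecke_lattice 0 by unfold_locales simp
  show "indef_sum same_parity
            (\<lambda>k m. (-1) ^ nat \<bar>m\<bar> * q_pow (k^2/2 + m^2/2 + 4*k*m + k/2 + 3*m/2))
          = (\<Prod>n. 1 + fps_X ^ Suc n) *
            indef_sum UNIV
              (\<lambda>k m. (-1) ^ nat \<bar>k + m\<bar> * q_pow (3*k^2 + m^2/2 + 4*k*m + k + m/2))"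
    by (rule indef_sum_identity[OF _ exponent_lhs1[THEN conjunct2] _ exponent_rhs1[THEN conjunct2]])
       (simp_all add: field_simps power2_eq_square)
next
  interpret hecke_lattice 1 by unfold_locales simp
  show "indef_sum same_parity
            (\<lambda>k m. (-1) ^ nat \<bar>m\<bar> * q_pow (k^2/2 + m^2/2 + 4*k*m + 3*k/2 + 5*m/2))
          = (\<Prod>n. 1 + fps_X ^ Suc n) *
            indef_sum UNIV
              (\<lambda>k m. (-1) ^ nat \<bar>k + m\<bar> * q_pow (3*k^2 + m^2/2 + 4*k*m + 3*k + 3*m/2))"
    by (rule indef_sum_identity[OF _ exponent_lhs2[THEN conjunct2] _ exponent_rhs2[THEN conjunct2]])
       (simp_all add: field_simps power2_eq_square)
qed

end
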